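(* Let $\lambda>0$ and $\beta\in(0,1]$. The convolution $C_{\pi_{\lambda,\beta}}$, defined for $\varphi\in(N)^1_{\pi_{\lambda,\beta}}$ by $$(C_{\pi_{\lambda,\beta}}\varphi)(z)=\int_{\mathbb{R}}\varphi(x+z)\,\mathrm{d}\pi_{\lambda,\beta}(x),\qquad z\in\mathbb{C},$$ is a homeomorphism between the test function space $(N)^1_{\pi_{\lambda,\beta}}$ and the space $\mathcal{E}^1_{\min}(\mathbb{C})$ of entire functions of minimal type and order of growth one.
   Context: $\mathbb{N}_0=\{0,1,2,\dots\}$. The Mittag-Leffler function is $E_\beta(z)=\sum_{n=0}^\infty \frac{z^n}{\Gamma(\beta n+1)}$. The fractional Poisson measure $\pi_{\lambda,\beta}$ is the probability measure on $\mathbb{R}$ concentrated on $\mathbb{N}_0$ with $\pi_{\lambda,\beta}(\{k\})=\frac{\lambda^k}{k!}E_\beta^{(k)}(-\lambda)$. The generalized Appell polynomials $C_n^{\lambda,\beta}$ (of degree $n$) are defined by $\frac{e^{x\log(1+z)}}{E_\beta(\lambda z)}=\sum_{n=0}^\infty\frac{z^n}{n!}C_n^{\lambda,\beta}(x)$ for $z$ near $0\in\mathbb{C}$. For $q\in\mathbb{N}_0$, $(H)^1_{q,\pi_{\lambda,\beta}}$ is the Hilbert space of series $\varphi=\sum_{n=0}^\infty\varphi_nC_n^{\lambda,\beta}$, $\varphi_n\in\mathbb{C}$, with $\|\varphi\|^2_{q,1,\pi_{\lambda,\beta}}=\sum_{n=0}^\infty(n!)^2 2^{nq}|\varphi_n|^2<\infty$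 (the completion of the complex polynomials in this norm). The test function space is $(N)^1_{\pi_{\lambda,\beta}}=\bigcap_{q\in\mathbb{N}_0}(H)^1_{q,\pi_{\lambda,\beta}}$, with the topology given by the norms $\|\cdot\|_{q,1,\pi_{\lambda,\beta}}$, $q\in\mathbb{N}_0$. Every $\varphi\in(N)^1_{\pi_{\lambda,\beta}}$ is identified with the entire function $\varphi(z)=\sum_{n=0}^\infty\varphi_nC_n^{\lambda,\beta}(z)$, $z\in\mathbb{C}$ (the series converges absolutely), which is used in the definition of $C_{\pi_{\lambda,\beta}}$. For $l\in\mathbb{N}_0$, $\mathcal{E}^1_{2^{-l}}(\mathbb{C})$ is the Banach space of entire functions $u$ with $|u|_{l,1}:=\sup_{z\in\mathbb{C}}|u(z)|\exp(-2^{-l}|z|)<\infty$, and $\mathcal{E}^1_{\min}(\mathbb{C})=\bigcap_{l\in\mathbb{N}_0}\mathcal{E}^1_{2^{-l}}(\mathbb{C})$, with the topology given by the norms $|\cdot|_{l,1}$, $l\in\mathbb{N}_0$. *)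

theory Defs
  imports "HOL-Complex_Analysis.Complex_Analysis"
begin

definition mittag_leffler :: "real \<Rightarrow> 'a \<Rightarrow> 'a :: {real_normed_field, banach}" where
  "mittag_leffler \<beta> z = (\<Sum>n. z ^ n / of_real (Gamma (\<beta> * real n + 1)))"

text \<open>The point masses are derivatives of the real Mittag-Leffler function.  They are
  nonnegative for \<open>0 < lam\<close> and \<open>0 < \<beta> \<le> 1\<close> (complete monotonicity of
  \<open>x \<mapsto> E\<^sub>\<beta>(-x)\<close>), so in this range \<^const>\<open>ennreal\<close> truncates nothing.\<close>

definition frac_poisson :: "real \<Rightarrow> real \<Rightarrow> real measure" where
  "frac_poisson lam \<beta> =
     distr (density (count_space (UNIV :: nat set))
              (\<lambda>k. ennreal (lam ^ k / fact k * (deriv ^^ k) (mittag_leffler \<beta>) (- lam))))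
           borel real"

definition appell_gen :: "real \<Rightarrow> real \<Rightarrow> complex \<Rightarrow> complex \<Rightarrow> complex" where
  "appell_gen lam \<beta> x z = exp (x * Ln (1 + z)) / mittag_leffler \<beta> (of_real lam * z)"

text \<open>\<open>n!\<close> times the \<open>n\<close>-th Taylor coefficient at 0 of the generating function; see
  \<open>appell_generating_function\<close> below.\<close>

definition appell :: "real \<Rightarrow> real \<Rightarrow> nat \<Rightarrow> complex \<Rightarrow> complex" where
  "appell lam \<beta> n x = (deriv ^^ n) (appell_gen lam \<beta> x) 0"

lemma powr_le_Gamma:
  fixes D x :: real
  assumes "D \<ge> 1" "x \<ge> 1"
  shows "D powr x \<le> D * exp D * Gamma (x + 1)"
proof -
  define m where "m = nat \<lfloor>x\<rfloor>"
  have m: "real m \<le> x" "x \<le> real m + 1" "m \<ge> 1"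
    using assms(2) unfolding m_def by linarith+
  have "D powr x \<le> D powr (real m + 1)"
    using assms m by (intro powr_mono) auto
  also have "\<dots> = D * D ^ m"
    using assms by (simp add: powr_add powr_realpow)
  also have "D ^ m \<le> exp D * fact m"
  proof -
    have "(\<Sum>n\<in>{m}. D ^ n /\<^sub>R fact n) \<le> (\<Sum>n. D ^ n /\<^sub>R fact n)"
      using assms by (intro sum_le_suminf summable_exp_generic) auto
    then show ?thesis by (simp add: exp_def field_simps)
  qed
  also have "fact m = Gamma (1 + real m)"
    by (rule Gamma_fact [symmetric])
  also have "Gamma (1 + real m) \<le> Gamma (x + 1)"
    using m Gamma_real_strict_mono[of "1 + real m" "x + 1"]
    by (cases "real m = x") (auto simp: add_ac)
  finally show ?thesis
    using assms by (simp add: mult_ac mult_left_mono)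
qed

lemma summable_mittag_leffler:
  fixes z :: "'a :: {real_normed_field, banach}"
  assumes "0 < \<beta>"
  shows "summable (\<lambda>n. z ^ n / of_real (Gamma (\<beta> * real n + 1)))"
proof -
  define B where "B = max 1 (2 * norm z)"
  define D where "D = B powr (1 / \<beta>)"
  have B: "B \<ge> 1" "norm z \<le> B / 2" by (auto simp: B_def)
  have D: "D \<ge> 1" using B assms by (auto simp: D_def ge_one_powr_ge_zero)
  have "eventually (\<lambda>n. norm (z ^ n / of_real (Gamma (\<beta> * real n + 1)))
          \<le> D * exp D * (1 / 2) ^ n) sequentially"
    using eventually_ge_at_top[of "nat \<lceil>1 / \<beta>\<rceil>"]
  proof eventually_elim
    case (elim n)
    then have "1 / \<beta> \<le> real n" by linarith
    then have n: "\<beta> * real n \<ge> 1" using assms by (simp add: field_simps)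
    have G: "Gamma (\<beta> * real n + 1) > 0" using n by (intro Gamma_real_pos) linarith
    have "norm z ^ n \<le> (B / 2) ^ n" using B by (intro power_mono) auto
    also have "\<dots> = (1 / 2) ^ n * D powr (\<beta> * real n)"
      using B assms by (simp add: D_def powr_powr powr_realpow power_divide)
    also have "\<dots> \<le> (1 / 2) ^ n * (D * exp D * Gamma (\<beta> * real n + 1))"
      using powr_le_Gamma[OF D n] by (intro mult_left_mono) auto
    finally show ?case
      using G by (simp add: norm_divide norm_power field_simps)
  qed
  moreover have "summable (\<lambda>n. D * exp D * (1 / 2 :: real) ^ n)"
    by (intro summable_mult summable_geometric) auto
  ultimately show ?thesis by (rule summable_comparison_test_ev)
qed

lemma mittag_leffler_0 [simp]: "mittag_leffler \<beta> 0 = 1"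
proof -
  have "(\<Sum>n. inverse (of_real (Gamma (\<beta> * real n + 1))) * (0 :: 'a) ^ n) = 1"
    by (subst powser_zero) auto
  then show ?thesis by (simp add: mittag_leffler_def field_simps)
qed

lemma holomorphic_mittag_leffler:
  assumes "0 < \<beta>"
  shows "mittag_leffler \<beta> holomorphic_on A"
proof -
  have "((\<lambda>z. \<Sum>n. inverse (of_real (Gamma (\<beta> * real n + 1))) * z ^ n)
          has_field_derivative
          (\<Sum>n. diffs (\<lambda>n. inverse (of_real (Gamma (\<beta> * real n + 1)))) n * z ^ n)) (at z)"
    for z :: complex
    using summable_mittag_leffler[OF assms]
    by (intro termdiffs_strong_converges_everywhere) (simp add: field_simps)
  then have "(mittag_leffler \<beta> :: complex \<Rightarrow> complex) field_differentiable at z" for z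
    unfolding field_differentiable_def mittag_leffler_def by (auto simp: field_simps)
  then show ?thesis
    by (simp add: field_differentiable_at_within holomorphic_onI)
qed

lemma appell_generating_function:
  assumes "0 < \<beta>"
  shows "\<forall>\<^sub>F z in nhds 0. (\<lambda>n. z ^ n / fact n * appell lam \<beta> n x) sums
           (exp (x * Ln (1 + z)) / mittag_leffler \<beta> (of_real lam * z))"
proof -
  let ?M = "\<lambda>z::complex. mittag_leffler \<beta> (of_real lam * z)"
  have M: "?M holomorphic_on A" for A
    using holomorphic_on_compose_gen[of "\<lambda>z. of_real lam * z" A "mittag_leffler \<beta>" UNIV]
      holomorphic_mittag_leffler[OF assms] by (auto simp: o_def intro!: holomorphic_intros)
  have "continuous_on UNIV ?M"
    by (rule holomorphic_on_imp_continuous_on[OF M])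
  then have "open {z. ?M z \<noteq> 0}"
    by (intro open_Collect_neq continuous_intros)
  then have "eventually (\<lambda>z. z \<in> {z. ?M z \<noteq> 0}) (nhds 0)"
    by (rule eventually_nhds_in_open) simp
  then have "eventually (\<lambda>z. ?M z \<noteq> 0) (nhds 0)" by simp
  then obtain r0 where r0: "r0 > 0" "\<And>z. dist z 0 < r0 \<Longrightarrow> ?M z \<noteq> 0"
    unfolding eventually_nhds_metric by blast
  define r where "r = min r0 1"
  have r: "r > 0" "r \<le> r0" "r \<le> 1" using r0 by (auto simp: r_def)
  have "1 + z \<notin> \<real>\<^sub>\<le>\<^sub>0" if "norm z < 1" for z :: complex
  proof
    assume "1 + z \<in> \<real>\<^sub>\<le>\<^sub>0"
    then have "Re z \<le> - 1" by (auto simp: complex_nonpos_Reals_iff)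
    then show False using that abs_Re_le_cmod[of z] by linarith
  qed
  then have hol: "appell_gen lam \<beta> x holomorphic_on ball 0 r"
    unfolding appell_gen_def using r r0
    by (intro holomorphic_intros M) (auto simp: dist_commute)
  have "(\<lambda>n. z ^ n / fact n * appell lam \<beta> n x) sums
           (exp (x * Ln (1 + z)) / mittag_leffler \<beta> (of_real lam * z))" if "z \<in> ball 0 r" for z
    using holomorphic_power_series[OF hol that]
    by (simp add: appell_def appell_gen_def mult_ac)
  then show ?thesis
    using r(1) eventually_nhds_in_open[of "ball 0 r" 0] by (auto elim!: eventually_mono)
qed

text \<open>An element \<open>\<Sum>n. \<phi>\<^sub>n C\<^sub>n\<close> of \<open>(H)\<^sup>1\<^sub>q\<close> is a formal series in the Appell
  polynomials and is represented by its coefficient sequence \<open>\<phi>\<close>.  The norms see only the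
  coefficients; \<open>lam\<close> and \<open>\<beta>\<close> enter through the evaluation \<open>series_eval\<close> of such a series as a
  function.\<close>

definition H1_space :: "nat \<Rightarrow> (nat \<Rightarrow> complex) set" where
  "H1_space q = {\<phi>. summable (\<lambda>n. (fact n)\<^sup>2 * 2 ^ (n * q) * (cmod (\<phi> n))\<^sup>2)}"

definition H1_norm :: "nat \<Rightarrow> (nat \<Rightarrow> complex) \<Rightarrow> real" where
  "H1_norm q \<phi> = sqrt (\<Sum>n. (fact n)\<^sup>2 * 2 ^ (n * q) * (cmod (\<phi> n))\<^sup>2)"

definition N1_space :: "(nat \<Rightarrow> complex) set" where
  "N1_space = (\<Inter>q. H1_space q)"

definition series_eval :: "real \<Rightarrow> real \<Rightarrow> (nat \<Rightarrow> complex) \<Rightarrow> complex \<Rightarrow> complex" where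
  "series_eval lam \<beta> \<phi> z = (\<Sum>n. \<phi> n * appell lam \<beta> n z)"

definition E1_space :: "nat \<Rightarrow> (complex \<Rightarrow> complex) set" where
  "E1_space l = {u. u holomorphic_on UNIV \<and>
     bdd_above (range (\<lambda>z. cmod (u z) * exp (- (cmod z / 2 ^ l))))}"

definition E1_norm :: "nat \<Rightarrow> (complex \<Rightarrow> complex) \<Rightarrow> real" where
  "E1_norm l u = (SUP z. cmod (u z) * exp (- (cmod z / 2 ^ l)))"

definition E1_min :: "(complex \<Rightarrow> complex) set" where
  "E1_min = (\<Inter>l. E1_space l)"

text \<open>The topology on \<open>V\<close> given by a sequence of norms: the coarsest one containing the
  relative open balls of every norm.\<close>

definition norms_topology :: "('a \<Rightarrow> 'b::minus) set \<Rightarrow> (nat \<Rightarrow> ('a \<Rightarrow> 'b) \<Rightarrow> real) \<Rightarrow> ('a \<Rightarrow> 'b) topology" where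
  "norms_topology V p =
     topology_generated_by {{y \<in> V. p q (\<lambda>a. y a - x a) < e} | x q e. x \<in> V \<and> 0 < e}"

definition N1_topology :: "(nat \<Rightarrow> complex) topology" where
  "N1_topology = norms_topology N1_space H1_norm"

definition E1_min_topology :: "(complex \<Rightarrow> complex) topology" where
  "E1_min_topology = norms_topology E1_min E1_norm"

definition convolution :: "real \<Rightarrow> real \<Rightarrow> (nat \<Rightarrow> complex) \<Rightarrow> complex \<Rightarrow> complex" where
  "convolution lam \<beta> \<phi> z = (LINT x|frac_poisson lam \<beta>. series_eval lam \<beta> \<phi> (of_real x + z))"

end

theory Submission
  imports Defs "HOL-Combinatorics.Stirling" "HOL-Real_Asymp.Real_Asymp"
begin

text \<open>Integrating \<open>(1 + w)\<^sup>x\<close> against the fractional Poisson measure gives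
  \<open>E\<^sub>\<beta>(lam w)\<close>, which cancels the denominator of the Appell generating function.  Hence the
  convolution maps \<open>C\<^sub>n\<close> to the falling factorial \<open>n! (z gchoose n)\<close>, and \<open>\<Sum>n. \<phi>\<^sub>n C\<^sub>n\<close> to a
  Newton interpolation series.  If \<open>n! \<bar>\<phi>\<^sub>n\<bar> \<le> A \<epsilon>\<^sup>n\<close>, then the binomial series bounds that
  Newton series by \<open>A (1 - \<epsilon>) powr (- \<bar>z\<bar>)\<close>, whose exponential type tends to 0 with \<open>\<epsilon>\<close>.
  Conversely, if \<open>\<bar>u z\<bar> \<le> A exp (\<delta> \<bar>z\<bar>)\<close>, then Cauchy's estimates and the exponential generating
  function of the Stirling numbers bound the \<open>n\<close>-th forward difference of \<open>u\<close> at 0 by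
  \<open>A (exp (e \<delta>) - 1)\<^sup>n\<close>.

  The point masses have to be nonnegative, i.e. \<open>x \<mapsto> E\<^sub>\<beta>(-x)\<close> has to be completely monotone.  This
  is obtained from a discretisation: \<open>(1 - X) powr \<beta> + h\<close> has a positive constant term and no other
  positive coefficient, so its reciprocal has nonnegative coefficients, and for \<open>h = x N powr (-\<beta>)\<close>
  the \<open>N\<close>-th coefficients of \<open>k! (1 - X) powr (\<beta> - 1) / ((1 - X) powr \<beta> + h)\<^sup>k\<^sup>+\<^sup>1\<close>, suitably
  rescaled, converge to \<open>E\<^sub>\<beta>\<close>'s \<open>k\<close>-th derivative at \<open>-x\<close>.\<close>

section \<open>Fubini for absolutely convergent double series\<close>

lemma double_series_swap:
  fixes f :: "nat \<Rightarrow> nat \<Rightarrow> 'a :: banach"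
  assumes "\<And>m. summable (\<lambda>n. norm (f m n))" and "summable (\<lambda>m. \<Sum>n. norm (f m n))"
  shows "summable (\<lambda>m. norm (f m n))"
    and "summable (\<lambda>n. \<Sum>m. norm (f m n))"
    and "(\<Sum>m. \<Sum>n. f m n) = (\<Sum>n. \<Sum>m. f m n)"
proof -
  have nonneg: "0 \<le> (\<Sum>n. norm (f m n))" for m
    using assms(1) by (intro suminf_nonneg) auto
  \<comment> \<open>Absolute convergence makes the ordered series and the unordered sum agree, and
    for unordered sums summability over the product is symmetric in the two indices.\<close>
  have eq: "infsum g UNIV = suminf g" if "summable (\<lambda>n. norm (g n))" for g :: "nat \<Rightarrow> 'b :: banach"
    using norm_summable_imp_has_sum[OF that summable_sums[OF summable_norm_cancel[OF that]]]
    by (rule infsumI)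
  have a: "(\<lambda>n. norm (f m n)) summable_on UNIV" for m
    using norm_summable_imp_summable_on[of "\<lambda>n. norm (f m n)"] assms(1) by simp
  have s: "(\<lambda>(m,n). norm (f m n)) summable_on UNIV \<times> UNIV"
  proof -
    have "(\<lambda>p. norm ((\<lambda>(m,n). f m n) p)) summable_on UNIV \<times> UNIV"
      unfolding Infinite_Sum.abs_summable_on_Sigma_iff
      using a assms nonneg norm_summable_imp_summable_on[of "\<lambda>m. \<Sum>n. norm (f m n)"]
      by (auto simp: eq)
    then show ?thesis by (simp add: case_prod_unfold)
  qed
  have "(\<lambda>p. norm ((\<lambda>(n,m). f m n) p)) summable_on UNIV \<times> UNIV"
    using s by (subst (asm) summable_on_swap) (simp add: case_prod_unfold)
  then have s': "(\<lambda>m. norm (f m n)) summable_on UNIV"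
     "(\<lambda>n. infsum (\<lambda>m. norm (f m n)) UNIV) summable_on UNIV" for n
    unfolding Infinite_Sum.abs_summable_on_Sigma_iff
    by (auto simp: infsum_nonneg)
  show 1: "summable (\<lambda>m. norm (f m n))" for n
    using s'(1) by (rule summable_on_imp_summable)
  show 2: "summable (\<lambda>n. \<Sum>m. norm (f m n))"
    using summable_on_imp_summable[OF s'(2)] 1 by (simp add: eq)
  have 3: "summable (\<lambda>n. norm (\<Sum>m. f m n))"
    using 2 by (rule summable_comparison_test') (use 1 in \<open>auto intro!: summable_norm\<close>)
  have 4: "summable (\<lambda>m. norm (\<Sum>n. f m n))"
    using assms(2) by (rule summable_comparison_test') (use assms(1) in \<open>auto intro!: summable_norm\<close>)
  have "(\<lambda>p. norm ((\<lambda>(m,n). f m n) p)) summable_on UNIV \<times> UNIV"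
    using s by (simp add: case_prod_unfold)
  then have "(\<lambda>(m,n). f m n) summable_on UNIV \<times> UNIV"
    by (rule abs_summable_summable)
  then have "infsum (\<lambda>m. infsum (\<lambda>n. f m n) UNIV) UNIV = infsum (\<lambda>n. infsum (\<lambda>m. f m n) UNIV) UNIV"
    by (rule infsum_swap_banach)
  then show "(\<Sum>m. \<Sum>n. f m n) = (\<Sum>n. \<Sum>m. f m n)"
    using 1 3 4 assms(1) by (simp add: eq)
qed

subsection \<open>Complete monotonicity of the Mittag-Leffler function\<close>

text \<open>The binomial series \<open>(1 - X) powr (-c)\<close>.\<close>

definition poch_fps :: "real \<Rightarrow> real fps" where
  "poch_fps c = Abs_fps (\<lambda>n. pochhammer c n / fact n)"

text \<open>Exponents of \<open>1 - X\<close> add; on coefficients this is the Vandermonde identity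
  for rising factorials.\<close>

lemma poch_fps_mult: "poch_fps a * poch_fps b = poch_fps (a + b)"
proof (rule fps_ext)
  fix n
  have "fps_nth (poch_fps (a + b)) n
      = (\<Sum>k\<le>n. of_nat (n choose k) * pochhammer a k * pochhammer b (n - k)) / fact n"
    by (simp add: poch_fps_def pochhammer_binomial_sum)
  also have "\<dots> = (\<Sum>k\<le>n. pochhammer a k / fact k * (pochhammer b (n - k) / fact (n - k)))"
    by (simp add: sum_divide_distrib binomial_fact field_simps)
  finally show "fps_nth (poch_fps a * poch_fps b) n = fps_nth (poch_fps (a + b)) n"
    by (simp add: fps_mult_nth poch_fps_def atLeast0AtMost)
qed

text \<open>Comparing coefficients in \<open>D * R\<close> gives a recursion in which the earlier
  coefficients of \<open>R\<close> enter with the nonnegative weights \<open>- fps_nth D i\<close>,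
  so nonnegativity propagates by strong induction.\<close>

lemma nonneg_of_mult_nonneg_fps:
  fixes D R :: "real fps"
  assumes "fps_nth D 0 > 0" "\<And>n. n > 0 \<Longrightarrow> fps_nth D n \<le> 0" "\<And>n. fps_nth (D * R) n \<ge> 0"
  shows "fps_nth R n \<ge> 0"
proof (induction n rule: less_induct)
  case (less n)
  have "0 \<le> fps_nth (D * R) n" by (rule assms)
  also have "\<dots> = fps_nth D 0 * fps_nth R n + (\<Sum>i=1..n. fps_nth D i * fps_nth R (n - i))"
    by (simp add: fps_mult_nth sum.atLeast_Suc_atMost)
  also have "(\<Sum>i=1..n. fps_nth D i * fps_nth R (n - i)) \<le> 0"
    by (intro sum_nonpos mult_nonpos_nonneg assms less) auto
  finally have "0 \<le> fps_nth D 0 * fps_nth R n" by simp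
  then show ?case using assms(1) by (simp add: zero_le_mult_iff)
qed

lemma summable_binomial_poly_geometric:
  fixes y \<beta> :: real
  assumes "0 \<le> y" "y < 1" "0 \<le> \<beta>" "\<beta> \<le> 1"
  shows "summable (\<lambda>n. real (n + k choose k) * y ^ n * (1 + \<beta> * real (n + k)) ^ M)"
proof (rule summable_comparison_test')
  show "summable (\<lambda>n. (1 + real (n + k)) ^ (k + M) * y ^ n)"
  proof (cases "y = 0")
    case True
    have "summable (\<lambda>n. if n = 0 then (1 + real (n + k)) ^ (k + M) else 0)"
      by (rule summable_single)
    also have "(\<lambda>n. if n = 0 then (1 + real (n + k)) ^ (k + M) else 0)
       = (\<lambda>n. (1 + real (n + k)) ^ (k + M) * y ^ n)"
      using True by auto
    finally show ?thesis .
  next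
    case False
    \<comment> \<open>A base strictly between \<open>y\<close> and 1 absorbs the polynomial
      factor.\<close>
    define z where "z = (y + 1) / 2"
    have z: "0 < y" "y < z" "0 < z" "z < 1" using False assms by (auto simp: z_def)
    have "(\<lambda>n. (1 + real (n + k)) ^ (k + M) * y ^ n) \<in> O(\<lambda>n. z ^ n)"
      using z by real_asymp
    moreover have "summable (\<lambda>n. norm (z ^ n))"
      using z by (simp add: norm_power)
    ultimately show ?thesis
      by (rule summable_comparison_test_bigo[rotated])
  qed
next
  fix n
  have "real (n + k choose k) \<le> real (n + k) ^ k"
    by (metis binomial_le_pow le_add2 of_nat_le_iff of_nat_power)
  also have "\<dots> \<le> (1 + real (n + k)) ^ k" by (intro power_mono) auto
  finally have 1: "real (n + k choose k) \<le> (1 + real (n + k)) ^ k" .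
  have 2: "(1 + \<beta> * real (n + k)) ^ M \<le> (1 + real (n + k)) ^ M"
    using assms mult_right_mono[of \<beta> 1 "real (n + k)"] by (intro power_mono) auto
  have "real (n + k choose k) * (1 + \<beta> * real (n + k)) ^ M \<le> (1 + real (n + k)) ^ k * (1 + real (n + k)) ^ M"
    using assms by (intro mult_mono 1 2) auto
  then have "real (n + k choose k) * (1 + \<beta> * real (n + k)) ^ M * y ^ n \<le> (1 + real (n + k)) ^ (k + M) * y ^ n"
    using assms by (intro mult_right_mono) (auto simp: power_add)
  then show "norm (real (n + k choose k) * y ^ n * (1 + \<beta> * real (n + k)) ^ M) \<le> (1 + real (n + k)) ^ (k + M) * y ^ n"
    using assms by (simp add: abs_mult mult_ac)
qed

text \<open>The ratio is the product of \<open>1 + a / i\<close> for i from 1 to \<open>N\<close>,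
  and each factor is at most \<open>1 + a\<close>.\<close>

lemma pochhammer_fact_le:
  fixes a :: real
  assumes "0 \<le> a"
  shows "pochhammer (a + 1) N / fact N \<le> (1 + a) ^ N"
proof (induction N)
  case (Suc N)
  have "pochhammer (a + 1) (Suc N) / fact (Suc N) = pochhammer (a + 1) N / fact N * ((a + 1 + N) / (N + 1))"
    by (simp add: pochhammer_Suc field_simps)
  also have "\<dots> \<le> (1 + a) ^ N * (1 + a)"
    using assms by (intro mult_mono Suc) (auto simp: field_simps)
  finally show ?case by (simp add: mult_ac)
qed simp

lemma pochhammer_nonneg': "0 \<le> a \<Longrightarrow> 0 \<le> pochhammer (a :: real) n"
  by (auto simp: pochhammer_prod intro!: prod_nonneg)

text \<open>The coefficients of \<open>(1 - X) powr (\<beta> - 1) / ((1 - X) powr \<beta> + h)\<^sup>k\<^sup>+\<^sup>1\<close>, expanded in powers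
  of \<open>h\<close>.\<close>

definition prabhakar_coeff :: "real \<Rightarrow> nat \<Rightarrow> real \<Rightarrow> nat \<Rightarrow> real" where
  "prabhakar_coeff \<beta> k h N =
     (\<Sum>n. real (n + k choose k) * (- h) ^ n * fps_nth (poch_fps (\<beta> * real (n + k) + 1)) N)"

lemma summable_prabhakar_coeff:
  assumes "0 \<le> h" "h < 1" "0 \<le> \<beta>" "\<beta> \<le> 1"
  shows "summable (\<lambda>n. real (n + k choose k) * (- h) ^ n * fps_nth (poch_fps (\<beta> * real (n + k) + 1)) N)"
proof (rule summable_comparison_test'[OF summable_binomial_poly_geometric[OF assms, of k N]])
  fix n
  have "0 \<le> pochhammer (\<beta> * real (n + k) + 1) N"
    using assms by (intro pochhammer_nonneg') auto
  then have "norm (real (n + k choose k) * (- h) ^ n * fps_nth (poch_fps (\<beta> * real (n + k) + 1)) N)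
     = real (n + k choose k) * h ^ n * (pochhammer (\<beta> * real (n + k) + 1) N / fact N)"
    using assms by (simp add: poch_fps_def abs_mult power_abs)
  also have "\<dots> \<le> real (n + k choose k) * h ^ n * (1 + \<beta> * real (n + k)) ^ N"
    using assms by (intro mult_left_mono pochhammer_fact_le) auto
  finally show "norm (real (n + k choose k) * (- h) ^ n * fps_nth (poch_fps (\<beta> * real (n + k) + 1)) N)
     \<le> real (n + k choose k) * h ^ n * (1 + \<beta> * real (n + k)) ^ N" .
qed

text \<open>With D = (1 - X) powr \<beta> + h and G_k = (1 - X) powr (\<beta> - 1) / D^(k+1), this
  is D G_k = G_(k-1), where G_(-1) = (1 - X) powr (\<beta> - 1). On the expansions in powers of
  \<open>h\<close> it reduces to Pascal's rule, because multiplying by (1 - X) powr \<beta> lowers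
  the index n + k in the exponent by one.\<close>

lemma prabhakar_coeff_mult:
  fixes \<beta> h :: real
  assumes "0 \<le> h" "h < 1" "0 \<le> \<beta>" "\<beta> \<le> 1"
  shows "fps_nth ((poch_fps (- \<beta>) + fps_const h) * Abs_fps (prabhakar_coeff \<beta> k h)) N =
     (case k of 0 \<Rightarrow> fps_nth (poch_fps (1 - \<beta>)) N | Suc k' \<Rightarrow> prabhakar_coeff \<beta> k' h N)"
proof -
  let ?D = "poch_fps (- \<beta>) + fps_const h"
  let ?c = "\<lambda>n. real (n + k choose k) * (- h) ^ n"
  let ?P = "\<lambda>n. poch_fps (\<beta> * real (n + k) + 1)"
  let ?Q = "\<lambda>n. fps_nth (poch_fps (\<beta> * real (n + k) + 1 - \<beta>)) N"
  note s = summable_prabhakar_coeff[OF assms]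
  have s1: "summable (\<lambda>n. fps_nth ?D i * (?c n * fps_nth (?P n) (N - i)))" for i
    by (intro summable_mult s)
  have eq: "(\<Sum>i\<le>N. fps_nth ?D i * (?c n * fps_nth (?P n) (N - i)))
      = ?c n * ?Q n + h * (?c n * fps_nth (?P n) N)" for n
  proof -
    have "(\<Sum>i\<le>N. fps_nth ?D i * (?c n * fps_nth (?P n) (N - i))) = ?c n * fps_nth (?D * ?P n) N"
      by (simp add: fps_mult_nth sum_distrib_left atLeast0AtMost mult_ac)
    also have "?D * ?P n = poch_fps (- \<beta>) * ?P n + fps_const h * ?P n"
      by (simp add: distrib_right)
    also have "poch_fps (- \<beta>) * ?P n = poch_fps (\<beta> * real (n + k) + 1 - \<beta>)"
      by (simp add: poch_fps_mult algebra_simps)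
    finally show ?thesis by (simp add: algebra_simps)
  qed
  have "fps_nth (?D * Abs_fps (prabhakar_coeff \<beta> k h)) N
     = (\<Sum>i\<le>N. fps_nth ?D i * (\<Sum>n. ?c n * fps_nth (?P n) (N - i)))"
    by (simp add: fps_mult_nth atLeast0AtMost prabhakar_coeff_def)
  also have "\<dots> = (\<Sum>i\<le>N. \<Sum>n. fps_nth ?D i * (?c n * fps_nth (?P n) (N - i)))"
    by (intro sum.cong refl suminf_mult[symmetric] s)
  also have "\<dots> = (\<Sum>n. \<Sum>i\<le>N. fps_nth ?D i * (?c n * fps_nth (?P n) (N - i)))"
    by (intro suminf_sum[symmetric] s1)
  also have "\<dots> = (\<Sum>n. ?c n * ?Q n + h * (?c n * fps_nth (?P n) N))"
    by (simp only: eq)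
  finally have 1: "fps_nth (?D * Abs_fps (prabhakar_coeff \<beta> k h)) N
     = (\<Sum>n. ?c n * ?Q n + h * (?c n * fps_nth (?P n) N))" .
  \<comment> \<open>The series with the extra factor \<open>h\<close>, with its sign changed and
    shifted by one place, so that its n-th term carries \<open>(- h) ^ n\<close> and the same
    binomial series as \<open>?Q n\<close>.\<close>
  define b where "b = (\<lambda>n. case n of 0 \<Rightarrow> 0 | Suc m \<Rightarrow> - h * (?c m * fps_nth (?P m) N))"
  have "summable (\<lambda>n. \<Sum>i\<le>N. fps_nth ?D i * (?c n * fps_nth (?P n) (N - i)))"
    by (intro summable_sum s1)
  then have sQ': "summable (\<lambda>n. ?c n * ?Q n + h * (?c n * fps_nth (?P n) N))"
    by (simp only: eq)
  then have sQ: "summable (\<lambda>n. ?c n * ?Q n)"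
    using summable_diff[OF sQ' summable_mult[OF s, of h k N]] by simp
  have sb': "summable (\<lambda>n. b (Suc n))"
    unfolding b_def nat.case by (intro summable_mult s)
  then have sb: "summable b" by (simp add: summable_Suc_iff)
  have "(\<Sum>n. ?c n * ?Q n + h * (?c n * fps_nth (?P n) N))
      = (\<Sum>n. ?c n * ?Q n) - (\<Sum>n. b (Suc n))"
    unfolding suminf_diff[OF sQ sb'] by (simp add: b_def)
  also have "(\<Sum>n. b (Suc n)) = suminf b"
  proof -
    have "b 0 = 0" by (simp add: b_def)
    then show ?thesis using suminf_split_head[OF sb] by simp
  qed
  also have "(\<Sum>n. ?c n * ?Q n) - suminf b = (\<Sum>n. ?c n * ?Q n - b n)"
    by (rule suminf_diff[OF sQ sb])
  \<comment> \<open>The two terms differ only in their binomial coefficients. Pascal's rule gives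
    the difference; for \<open>k = 0\<close> it vanishes except at \<open>n = 0\<close>.\<close>
  also have "\<dots> = (case k of 0 \<Rightarrow> fps_nth (poch_fps (1 - \<beta>)) N | Suc k' \<Rightarrow> prabhakar_coeff \<beta> k' h N)"
  proof (cases k)
    case 0
    have "?c n * ?Q n - b n = (if n = 0 then fps_nth (poch_fps (1 - \<beta>)) N else 0)" for n
      using 0 by (auto simp: b_def algebra_simps split: nat.splits)
    then show ?thesis
      using 0 suminf_finite[of "{0}" "\<lambda>n. if n = 0 then fps_nth (poch_fps (1 - \<beta>)) N else 0"]
      by simp
  next
    case (Suc k')
    have "?c n * ?Q n - b n
       = real (n + k' choose k') * (- h) ^ n * fps_nth (poch_fps (\<beta> * real (n + k') + 1)) N" for n
      using Suc by (cases n) (auto simp: b_def algebra_simps)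
    then show ?thesis
      using Suc by (simp add: prabhakar_coeff_def)
  qed
  finally show ?thesis using 1 by simp
qed

text \<open>Induction on \<open>k\<close>: by \<open>prabhakar_coeff_mult\<close> each step divides
  by a series of the kind treated in \<open>nonneg_of_mult_nonneg_fps\<close>, starting from (1 - X)
  powr (\<beta> - 1), whose coefficients are nonnegative.\<close>

lemma prabhakar_coeff_nonneg:
  fixes \<beta> h :: real
  assumes "0 \<le> h" "h < 1" "0 \<le> \<beta>" "\<beta> \<le> 1"
  shows "0 \<le> prabhakar_coeff \<beta> k h N"
proof -
  let ?D = "poch_fps (- \<beta>) + fps_const h"
  have D0: "fps_nth ?D 0 > 0" using assms by (simp add: poch_fps_def)
  \<comment> \<open>\<open>pochhammer (- \<beta>) (Suc m)\<close> is \<open>- \<beta>\<close> times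
    \<open>pochhammer (1 - \<beta>) m\<close>, and the latter is nonnegative because \<beta> is at
    most 1.\<close>
  have Dn: "fps_nth ?D n \<le> 0" if n: "n > 0" for n
  proof -
    obtain m where "n = Suc m" using n by (cases n) auto
    then show ?thesis
      using assms pochhammer_nonneg'[of "1 - \<beta>" m]
      by (auto simp: poch_fps_def pochhammer_rec field_simps)
  qed
  have "fps_nth (Abs_fps (prabhakar_coeff \<beta> k h)) N \<ge> 0"
  proof (induction k arbitrary: N)
    case 0
    show ?case
    proof (rule nonneg_of_mult_nonneg_fps[OF D0 Dn])
      fix n
      have "0 \<le> fps_nth (poch_fps (1 - \<beta>)) n"
        using pochhammer_nonneg'[of "1 - \<beta>" n] assms by (simp add: poch_fps_def)
      then show "0 \<le> fps_nth (?D * Abs_fps (prabhakar_coeff \<beta> 0 h)) n"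
        by (simp only: prabhakar_coeff_mult[OF assms] nat.case)
    qed
  next
    case (Suc k)
    show ?case
      by (rule nonneg_of_mult_nonneg_fps[OF D0 Dn])
        (use Suc in \<open>simp_all add: prabhakar_coeff_mult[OF assms]\<close>)
  qed
  then show ?thesis by simp
qed

text \<open>The \<open>N\<close>-th coefficient of (1 - X) powr (- a - 1), rescaled so that its
  limit in \<open>N\<close> is 1 / \<Gamma>(a + 1).\<close>

definition gamma_ratio :: "nat \<Rightarrow> real \<Rightarrow> real" where
  "gamma_ratio N a = pochhammer (a + 1) N / fact N * real N powr (- a)"

lemma gamma_ratio_nonneg: "0 \<le> a \<Longrightarrow> 0 \<le> gamma_ratio N a"
  using pochhammer_nonneg'[of "a + 1" N] by (simp add: gamma_ratio_def)

text \<open>Gauss's limit formula for the reciprocal Gamma function. \<open>rGamma_series\<close> at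
  \<open>a + 1\<close> has one rising factor and one power of \<open>N\<close> more; their quotient
  tends to 1.\<close>

lemma gamma_ratio_tendsto: "(\<lambda>N. gamma_ratio N a) \<longlonglongrightarrow> 1 / Gamma (a + 1)"
proof -
  have "(\<lambda>N. rGamma_series (a + 1) N * (real N / (a + 1 + real N))) \<longlonglongrightarrow> rGamma (a + 1) * 1"
    by (intro tendsto_mult rGamma_series_LIMSEQ) real_asymp
  moreover have "eventually (\<lambda>N. rGamma_series (a + 1) N * (real N / (a + 1 + real N)) = gamma_ratio N a) sequentially"
    using eventually_gt_at_top[of "nat \<lceil>\<bar>a + 1\<bar>\<rceil>"]
  proof eventually_elim
    case (elim N)
    then have N: "real N > 0" "a + 1 + real N > 0" by linarith+
    have "exp ((a + 1) * ln (real N)) = real N powr (a + 1)"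
      using N by (simp add: powr_def)
    also have "\<dots> = real N powr a * real N"
      using N by (simp add: powr_add)
    finally have e: "exp ((a + 1) * of_real (ln (real N))) = real N powr a * real N" by simp
    define d where "d = a + 1 + real N"
    have P: "pochhammer (a + 1) (N + 1) = pochhammer (a + 1) N * d"
      by (simp add: pochhammer_Suc d_def)
    have "d > 0" using N by (simp add: d_def)
    then show ?case
      using N(1) unfolding gamma_ratio_def rGamma_series_def e P d_def[symmetric]
      by (simp add: powr_minus field_simps)
  qed
  ultimately show ?thesis
    using Lim_transform_eventually[of "\<lambda>N. rGamma_series (a + 1) N * (real N / (a + 1 + real N))"]
    by (simp add: rGamma_inverse_Gamma divide_inverse)
qed

text \<open>Consecutive terms have the quotient (1 + a / (N + 1)) (N / (N + 1)) powr a, which is at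
  most 1 since 1 / (N + 1) is at most ln ((N + 1) / N). This makes the value at one fixed index a
  majorant for all later ones.\<close>

lemma gamma_ratio_antimono:
  assumes "0 \<le> a" "1 \<le> M" "M \<le> N"
  shows "gamma_ratio N a \<le> gamma_ratio M a"
  using assms(3)
proof (induction N rule: dec_induct)
  case (step N)
  then have N: "real N > 0" using assms by simp
  have "ln (real N / (real N + 1)) \<le> real N / (real N + 1) - 1"
    using N by (intro ln_le_minus_one) simp
  then have "1 / (real N + 1) \<le> ln ((real N + 1) / real N)"
    using N by (simp add: ln_div field_simps)
  then have "1 + a * (1 / (real N + 1)) \<le> 1 + a * ln ((real N + 1) / real N)"
    using assms by (intro add_left_mono mult_left_mono) auto
  also have "\<dots> \<le> exp (a * ln ((real N + 1) / real N))"
    by (rule exp_ge_add_one_self)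
  also have "\<dots> = ((real N + 1) / real N) powr a"
    using N by (simp add: powr_def)
  also have "\<dots> = (real N + 1) powr a * real N powr (-a)"
    using N by (simp add: powr_divide powr_minus field_simps)
  also have "1 + a * (1 / (real N + 1)) = (a + 1 + real N) / (real N + 1)"
    using N by (simp add: field_simps)
  finally have "(a + 1 + real N) / (real N + 1) * (real N + 1) powr (- a)
      \<le> (real N + 1) powr a * real N powr (- a) * (real N + 1) powr (- a)"
    by (rule mult_right_mono) simp
  also have "\<dots> = real N powr (- a)"
    using N by (simp add: powr_minus)
  finally have "(a + 1 + real N) / (real N + 1) * (real N + 1) powr (- a) \<le> real N powr (- a)" .
  then have "pochhammer (a + 1) N / fact N * ((a + 1 + real N) / (real N + 1) * (real N + 1) powr (- a))
      \<le> gamma_ratio N a"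
    unfolding gamma_ratio_def using assms pochhammer_nonneg'[of "a + 1" N]
    by (intro mult_left_mono) auto
  moreover have "pochhammer (a + 1) N / fact N * ((a + 1 + real N) / (real N + 1) * (real N + 1) powr (- a))
      = gamma_ratio (Suc N) a"
    unfolding gamma_ratio_def by (simp add: pochhammer_Suc add_ac field_simps)
  ultimately show ?case using step by simp
qed simp

text \<open>The sum is the \<open>k\<close>-th derivative of the Mittag-Leffler function at
  \<open>- x\<close>, divided by k!. Replacing each 1 / \<Gamma> by \<open>gamma_ratio N\<close>
  yields a positive multiple of a \<open>prabhakar_coeff\<close>, and Tannery's theorem passes to
  the limit in \<open>N\<close>.\<close>

lemma mittag_leffler_deriv_series_nonneg:
  fixes \<beta> x :: real
  assumes "0 < \<beta>" "\<beta> \<le> 1" "0 \<le> x"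
  shows "0 \<le> (\<Sum>n. real (n + k choose k) * (- x) ^ n / Gamma (\<beta> * real (n + k) + 1))"
proof -
  have "((\<lambda>N. real N powr (-\<beta>)) \<longlonglongrightarrow> 0)"
    using assms by real_asymp
  then have "((\<lambda>N. x * real N powr (-\<beta>)) \<longlonglongrightarrow> x * 0)"
    by (intro tendsto_mult tendsto_const)
  then have ev: "eventually (\<lambda>N. x * real N powr (-\<beta>) < 1) sequentially"
    by (rule order_tendstoD) simp
  obtain N0 where N0: "\<And>N. N \<ge> N0 \<Longrightarrow> N \<ge> 1 \<and> x * real N powr (-\<beta>) < 1"
    using eventually_conj[OF ev eventually_ge_at_top[of "1::nat"]]
    by (auto simp: eventually_at_top_linorder)
  define t where "t = (\<lambda>n N. real (n + k choose k) * (- x) ^ n * gamma_ratio N (\<beta> * real (n + k)))"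
  \<comment> \<open>From \<open>N0\<close> on, \<open>h\<close> stays below 1, so the expansions in
    \<open>h\<close> converge; since \<open>gamma_ratio\<close> decreases in \<open>N\<close>, the
    absolute values of the terms at \<open>N0\<close> dominate all later ones.\<close>
  define M where "M = (\<lambda>n. real (n + k choose k) * x ^ n * gamma_ratio N0 (\<beta> * real (n + k)))"
  let ?y = "real N0 powr (-\<beta>)"
  have y: "0 \<le> x * ?y" "x * ?y < 1" using N0[of N0] assms by auto
  have pw: "real N powr (- (\<beta> * real m)) = (real N powr (-\<beta>)) ^ m" if "N \<ge> 1" for N m
    using that powr_powr[of "real N" "-\<beta>" "real m"] by (simp add: powr_realpow)
  have "summable M"
  proof (rule summable_comparison_test')
    show "summable (\<lambda>n. ?y ^ k * (real (n + k choose k) * (x * ?y) ^ n * (1 + \<beta> * real (n + k)) ^ N0))"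
      using assms y by (intro summable_mult summable_binomial_poly_geometric) auto
    fix n
    have "pochhammer (\<beta> * real (n + k) + 1) N0 / fact N0 * ?y ^ (n + k)
       \<le> (1 + \<beta> * real (n + k)) ^ N0 * ?y ^ (n + k)"
      using assms by (intro mult_right_mono pochhammer_fact_le) auto
    then have "real (n + k choose k) * x ^ n * (pochhammer (\<beta> * real (n + k) + 1) N0 / fact N0 * ?y ^ (n + k))
       \<le> real (n + k choose k) * x ^ n * ((1 + \<beta> * real (n + k)) ^ N0 * ?y ^ (n + k))"
      using assms by (intro mult_left_mono) auto
    moreover have "M n = real (n + k choose k) * x ^ n * (pochhammer (\<beta> * real (n + k) + 1) N0 / fact N0 * ?y ^ (n + k))"
      unfolding M_def gamma_ratio_def using N0[of N0] by (subst pw) auto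
    moreover have "0 \<le> M n"
      unfolding M_def using assms by (intro mult_nonneg_nonneg gamma_ratio_nonneg) auto
    ultimately show "norm (M n) \<le> ?y ^ k * (real (n + k choose k) * (x * ?y) ^ n * (1 + \<beta> * real (n + k)) ^ N0)"
      by (simp add: power_add power_mult_distrib mult_ac)
  qed
  have lim: "((\<lambda>N. t n N) \<longlonglongrightarrow> real (n + k choose k) * (- x) ^ n * (1 / Gamma (\<beta> * real (n + k) + 1)))" for n
    unfolding t_def by (intro tendsto_mult tendsto_const gamma_ratio_tendsto)
  have "eventually (\<lambda>(n,N). norm (t n N) \<le> M n) (at_top \<times>\<^sub>F sequentially)"
    unfolding eventually_prod_filter
  proof (intro exI conjI allI impI)
    show "eventually (\<lambda>n. True) at_top" by simp
    show "eventually (\<lambda>N. N \<ge> N0) sequentially" by (rule eventually_ge_at_top)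
    fix n N :: nat assume N: "N0 \<le> N"
    have "gamma_ratio N (\<beta> * real (n + k)) \<le> gamma_ratio N0 (\<beta> * real (n + k))"
      using assms N N0[of N0] by (intro gamma_ratio_antimono) auto
    then have "real (n + k choose k) * x ^ n * gamma_ratio N (\<beta> * real (n + k)) \<le> M n"
      unfolding M_def using assms by (intro mult_left_mono) auto
    moreover have "0 \<le> gamma_ratio N (\<beta> * real (n + k))"
      using assms by (intro gamma_ratio_nonneg) auto
    ultimately show "case (n, N) of (n, N) \<Rightarrow> norm (t n N) \<le> M n"
      using assms by (simp add: t_def abs_mult power_abs)
  qed
  from tannerys_theorem[OF lim this \<open>summable M\<close>]
  have L: "(\<lambda>N. \<Sum>n. t n N) \<longlonglongrightarrow> (\<Sum>n. real (n + k choose k) * (- x) ^ n * (1 / Gamma (\<beta> * real (n + k) + 1)))"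
    by simp
  have "(\<Sum>n. t n N) \<ge> 0" if N: "N \<ge> N0" for N
  proof -
    let ?h = "x * real N powr (-\<beta>)"
    have h: "0 \<le> ?h" "?h < 1" using N0[OF N] assms by auto
    \<comment> \<open>Of the \<open>n + k\<close> factors \<open>real N powr (-\<beta>)\<close> in
      \<open>gamma_ratio\<close>, \<open>n\<close> combine with the powers of \<open>- x\<close> to
      \<open>(- ?h) ^ n\<close> and \<open>k\<close> are pulled out in front.\<close>
    have "(\<Sum>n. t n N) = (\<Sum>n. (real N powr (-\<beta>)) ^ k * (real (n + k choose k) * (- ?h) ^ n * fps_nth (poch_fps (\<beta> * real (n + k) + 1)) N))"
      unfolding t_def gamma_ratio_def
    proof (intro suminf_cong, subst pw)
      fix n
      have "(- x * real N powr (-\<beta>)) ^ n = (-x) ^ n * (real N powr (-\<beta>)) ^ n"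
        by (rule power_mult_distrib)
      then show "real (n + k choose k) * (- x) ^ n * (pochhammer (\<beta> * real (n + k) + 1) N / fact N * (real N powr - \<beta>) ^ (n + k)) =
         (real N powr - \<beta>) ^ k * (real (n + k choose k) * (- (x * real N powr - \<beta>)) ^ n * poch_fps (\<beta> * real (n + k) + 1) $ N)"
        by (simp add: poch_fps_def power_add)
    qed (use N0[OF N] in auto)
    also have "\<dots> = (real N powr (-\<beta>)) ^ k * prabhakar_coeff \<beta> k ?h N"
      unfolding prabhakar_coeff_def using assms h
      by (intro suminf_mult summable_prabhakar_coeff) auto
    also have "\<dots> \<ge> 0"
      using assms h by (intro mult_nonneg_nonneg prabhakar_coeff_nonneg) auto
    finally show ?thesis .
  qed
  then have "0 \<le> (\<Sum>n. real (n + k choose k) * (- x) ^ n * (1 / Gamma (\<beta> * real (n + k) + 1)))"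
    by (intro tendsto_lowerbound[OF L]) (auto simp: eventually_at_top_linorder intro!: exI[of _ N0])
  then show ?thesis by simp
qed

subsection \<open>Integration against the fractional Poisson measure\<close>

text \<open>Trinomial revision factors out \<open>m choose i\<close> and leaves the expansion of (1
  - 1)^(m - i). This is binomial inversion.\<close>

lemma binomial_orthogonality:
  "(\<Sum>k\<le>m. of_nat (m choose k) * (- 1) ^ (m - k) * of_nat (k choose i)) =
     (if m = i then 1 else (0 :: 'a :: comm_ring_1))"
proof (cases "i \<le> m")
  case True
  have "(\<Sum>k\<le>m. of_nat (m choose k) * (- 1) ^ (m - k) * of_nat (k choose i))
     = (\<Sum>k\<in>{i..m}. of_nat ((m choose k) * (k choose i)) * (- 1 :: 'a) ^ (m - k))"
    by (rule sum.mono_neutral_cong_right) (auto simp: mult_ac binomial_eq_0)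
  also have "\<dots> = (\<Sum>k\<in>{i..m}. of_nat ((m choose i) * (m - i choose (k - i))) * (- 1) ^ (m - k))"
    by (intro sum.cong refl) (simp add: choose_mult)
  also have "\<dots> = (\<Sum>j\<le>m - i. of_nat ((m choose i) * (m - i choose j)) * (- 1) ^ (m - i - j))"
    by (rule sum.reindex_bij_witness[of _ "\<lambda>j. j + i" "\<lambda>k. k - i"]) (use True in auto)
  also have "\<dots> = of_nat (m choose i) * (1 + (- 1)) ^ (m - i)"
    unfolding binomial_ring by (simp add: sum_distrib_left mult_ac)
  also have "\<dots> = (if m = i then 1 else 0)"
    using True by (auto simp: power_0_left)
  finally show ?thesis .
next
  case False
  then have "(\<Sum>k\<le>m. of_nat (m choose k) * (- 1) ^ (m - k) * of_nat (k choose i)) = (0 :: 'a)"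
    by (intro sum.neutral) (auto simp: binomial_eq_0)
  then show ?thesis using False by auto
qed

lemma higher_deriv_powser_everywhere:
  fixes c :: "nat \<Rightarrow> 'a :: {real_normed_field, banach}"
  assumes "\<And>y. summable (\<lambda>n. c n * y ^ n)"
  shows "(deriv ^^ k) (\<lambda>x. \<Sum>n. c n * x ^ n) = (\<lambda>x. \<Sum>n. fact (n + k) / fact n * c (n + k) * x ^ n)"
    and "summable (\<lambda>n. fact (n + k) / fact n * c (n + k) * x ^ n)"
proof -
  have "(deriv ^^ k) (\<lambda>x. \<Sum>n. c n * x ^ n) = (\<lambda>x. \<Sum>n. fact (n + k) / fact n * c (n + k) * x ^ n)
      \<and> (\<forall>y. summable (\<lambda>n. fact (n + k) / fact n * c (n + k) * y ^ n))"
  proof (induction k)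
    case 0
    then show ?case using assms by simp
  next
    case (Suc k)
    define d where "d = (\<lambda>n. fact (n + k) / fact n * c (n + k))"
    have s: "summable (\<lambda>n. d n * y ^ n)" for y using Suc by (simp add: d_def)
    have diffs: "diffs d = (\<lambda>n. fact (n + Suc k) / fact n * c (n + Suc k))"
    proof
      fix n
      have "diffs d n = of_nat (Suc n) * (fact (n + Suc k) / fact (Suc n) * c (n + Suc k))"
        by (simp add: diffs_def d_def del: of_nat_Suc fact_Suc)
      also have "(fact (Suc n) :: 'a) = of_nat (Suc n) * fact n" by (rule fact_Suc)
      finally show "diffs d n = fact (n + Suc k) / fact n * c (n + Suc k)"
        by (simp add: field_simps del: of_nat_Suc fact_Suc)
    qed
    have "(deriv ^^ Suc k) (\<lambda>x. \<Sum>n. c n * x ^ n) = deriv (\<lambda>x. \<Sum>n. d n * x ^ n)"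
      using Suc by (simp add: d_def)
    also have "\<dots> = (\<lambda>x. \<Sum>n. diffs d n * x ^ n)"
      by (intro ext DERIV_imp_deriv termdiffs_strong_converges_everywhere s)
    finally show ?case
      using termdiff_converges_all[OF s] by (simp add: diffs)
  qed
  then show "(deriv ^^ k) (\<lambda>x. \<Sum>n. c n * x ^ n) = (\<lambda>x. \<Sum>n. fact (n + k) / fact n * c (n + k) * x ^ n)"
    and "summable (\<lambda>n. fact (n + k) / fact n * c (n + k) * x ^ n)" by auto
qed

definition frac_poisson_mass :: "real \<Rightarrow> real \<Rightarrow> nat \<Rightarrow> real" where
  "frac_poisson_mass lam \<beta> k = lam ^ k / fact k * (deriv ^^ k) (mittag_leffler \<beta>) (- lam)"

lemma frac_poisson_mass_eq:
  assumes "0 < \<beta>"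
  shows "frac_poisson_mass lam \<beta> k =
    lam ^ k * (\<Sum>n. real (n + k choose k) * (- lam) ^ n / Gamma (\<beta> * real (n + k) + 1))"
    and "summable (\<lambda>n. real (n + k choose k) * (- lam) ^ n / Gamma (\<beta> * real (n + k) + 1))"
proof -
  let ?c = "\<lambda>n. 1 / Gamma (\<beta> * real n + 1)"
  have s: "summable (\<lambda>n. ?c n * y ^ n)" for y :: real
    using summable_mittag_leffler[OF assms, of y] by simp
  have ml: "mittag_leffler \<beta> = (\<lambda>x::real. \<Sum>n. ?c n * x ^ n)"
    by (auto simp: mittag_leffler_def)
  have eq: "fact (n + k) / fact n * ?c (n + k) * y ^ n
       = fact k * (real (n + k choose k) * y ^ n / Gamma (\<beta> * real (n + k) + 1))" for n y
    by (simp add: binomial_fact)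
  have "summable (\<lambda>n. fact k * (real (n + k choose k) * (- lam) ^ n / Gamma (\<beta> * real (n + k) + 1)))"
    using higher_deriv_powser_everywhere(2)[OF s, of k "- lam"] by (simp only: eq)
  then show sm: "summable (\<lambda>n. real (n + k choose k) * (- lam) ^ n / Gamma (\<beta> * real (n + k) + 1))"
    by (subst (asm) summable_cmult_iff) simp
  have "(deriv ^^ k) (mittag_leffler \<beta>) (- lam) =
       (\<Sum>n. fact k * (real (n + k choose k) * (- lam) ^ n / Gamma (\<beta> * real (n + k) + 1)))"
    unfolding ml higher_deriv_powser_everywhere(1)[OF s] by (simp only: eq)
  also have "\<dots> = fact k * (\<Sum>n. real (n + k choose k) * (- lam) ^ n / Gamma (\<beta> * real (n + k) + 1))"
    by (rule suminf_mult[OF sm])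
  finally show "frac_poisson_mass lam \<beta> k =
    lam ^ k * (\<Sum>n. real (n + k choose k) * (- lam) ^ n / Gamma (\<beta> * real (n + k) + 1))"
    by (simp add: frac_poisson_mass_def)
qed

lemma frac_poisson_mass_nonneg:
  assumes "0 \<le> lam" "0 < \<beta>" "\<beta> \<le> 1"
  shows "0 \<le> frac_poisson_mass lam \<beta> k"
  unfolding frac_poisson_mass_eq(1)[OF assms(2)]
  using assms by (intro mult_nonneg_nonneg mittag_leffler_deriv_series_nonneg) auto

text \<open>Nonnegative masses survive the passage through \<open>ennreal\<close> in the density, so
  the Bochner integral becomes the series over the atoms weighted by them.\<close>

lemma frac_poisson_integral:
  fixes f :: "real \<Rightarrow> complex"
  assumes "0 \<le> lam" "0 < \<beta>" "\<beta> \<le> 1" and [measurable]: "f \<in> borel_measurable borel"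
    and "summable (\<lambda>k. norm (of_real (frac_poisson_mass lam \<beta> k) * f (real k)))"
  shows "integrable (frac_poisson lam \<beta>) f"
    and "integral\<^sup>L (frac_poisson lam \<beta>) f = (\<Sum>k. of_real (frac_poisson_mass lam \<beta> k) * f (real k))"
proof -
  let ?D = "density (count_space (UNIV :: nat set)) (\<lambda>k. ennreal (frac_poisson_mass lam \<beta> k))"
  have fp: "frac_poisson lam \<beta> = distr ?D borel real"
    by (simp add: frac_poisson_def frac_poisson_mass_def)
  have nn: "AE k in count_space UNIV. 0 \<le> frac_poisson_mass lam \<beta> k"
    using frac_poisson_mass_nonneg[OF assms(1-3)] by simp
  have i: "integrable (count_space UNIV) (\<lambda>k. frac_poisson_mass lam \<beta> k *\<^sub>R f (real k))"
    using assms(5) by (simp add: integrable_count_space_nat_iff scaleR_conv_of_real)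
  show "integrable (frac_poisson lam \<beta>) f"
    unfolding fp by (subst integrable_distr_eq) (simp_all add: integrable_density nn i)
  show "integral\<^sup>L (frac_poisson lam \<beta>) f = (\<Sum>k. of_real (frac_poisson_mass lam \<beta> k) * f (real k))"
    unfolding fp
    by (subst integral_distr) (simp_all add: integral_density nn integral_count_space_nat[OF i, unfolded scaleR_conv_of_real] scaleR_conv_of_real)
qed

text \<open>Inserting the power series of the masses and collecting terms by total degree
  \<open>m = n + k\<close> produces the \<open>m\<close>-th forward difference of \<open>c\<close>
  at 0. The geometric bound on \<open>c\<close> makes the double series absolutely convergent, with
  the Mittag-Leffler series at \<open>lam * (1 + s)\<close> as majorant.\<close>

lemma frac_poisson_mass_sum:
  fixes c :: "nat \<Rightarrow> complex"
  assumes "0 < lam" "0 < \<beta>" "0 \<le> s" and c: "\<And>k. norm (c k) \<le> B * s ^ k"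
  shows "summable (\<lambda>k. norm (of_real (frac_poisson_mass lam \<beta> k) * c k))"
    and "(\<Sum>k. of_real (frac_poisson_mass lam \<beta> k) * c k) =
       (\<Sum>m. of_real (lam ^ m / Gamma (\<beta> * real m + 1)) *
          (\<Sum>k\<le>m. of_nat (m choose k) * (- 1) ^ (m - k) * c k))"
proof -
  define e where "e = (\<lambda>m. lam ^ m / Gamma (\<beta> * real m + 1))"
  have G: "Gamma (\<beta> * real m + 1) > 0" for m
    using assms by (intro Gamma_real_pos add_nonneg_pos) auto
  have e: "e m \<ge> 0" for m using G[of m] assms by (simp add: e_def)
  define f where "f = (\<lambda>m k. if k \<le> m then of_real (e m) * (of_nat (m choose k) * (- 1) ^ (m - k) * c k) else 0)"
  have inner: "(\<Sum>k. h (f m k)) = (\<Sum>k\<le>m. h (f m k))" if "h 0 = 0" for h :: "complex \<Rightarrow> 'b :: banach" and m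
    by (rule suminf_finite) (auto simp: f_def that)
  have 1: "summable (\<lambda>k. norm (f m k))" for m
    by (rule summable_finite[of "{..m}"]) (auto simp: f_def)
  have bd: "(\<Sum>k. norm (f m k)) \<le> B * ((lam * (1 + s)) ^ m / Gamma (\<beta> * real m + 1))" for m
  proof -
    have "(\<Sum>k. norm (f m k)) = (\<Sum>k\<le>m. e m * (real (m choose k) * norm (c k)))"
      using e by (subst inner) (auto simp: f_def norm_mult norm_power intro!: sum.cong)
    also have "\<dots> \<le> (\<Sum>k\<le>m. e m * (real (m choose k) * (B * s ^ k)))"
      using e c by (intro sum_mono mult_left_mono) auto
    also have "\<dots> = e m * B * (s + 1) ^ m"
      unfolding binomial_ring by (simp add: sum_distrib_left mult_ac)
    finally show ?thesis by (simp add: e_def power_mult_distrib add_ac mult_ac)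
  qed
  have 2: "summable (\<lambda>m. \<Sum>k. norm (f m k))"
  proof (rule summable_comparison_test')
    show "summable (\<lambda>m. B * ((lam * (1 + s)) ^ m / Gamma (\<beta> * real m + 1)))"
      using summable_mittag_leffler[OF assms(2), of "lam * (1 + s)"] by (intro summable_mult) simp
    show "norm (\<Sum>k. norm (f m k)) \<le> B * ((lam * (1 + s)) ^ m / Gamma (\<beta> * real m + 1))" for m
      using bd[of m] suminf_nonneg[OF 1[of m]] by simp
  qed
  note sw = double_series_swap[of f, OF 1 2]
  have outer: "(\<Sum>m. f m k) = of_real (frac_poisson_mass lam \<beta> k) * c k" for k
  proof -
    have "summable (\<lambda>m. f m k)" using sw(1) by (rule summable_norm_cancel)
    then have "(\<Sum>m. f m k) = (\<Sum>n. f (n + k) k)"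
      by (subst suminf_minus_initial_segment) (auto simp: f_def)
    also have "\<dots> = (\<Sum>n. of_real (lam ^ k * (real (n + k choose k) * (- lam) ^ n / Gamma (\<beta> * real (n + k) + 1))) * c k)"
      by (intro suminf_cong) (simp add: f_def e_def power_add power_minus[of lam] mult_ac)
    also have "\<dots> = of_real (\<Sum>n. lam ^ k * (real (n + k choose k) * (- lam) ^ n / Gamma (\<beta> * real (n + k) + 1))) * c k"
    proof -
      have sm: "summable (\<lambda>n. lam ^ k * (real (n + k choose k) * (- lam) ^ n / Gamma (\<beta> * real (n + k) + 1)))"
        by (intro summable_mult frac_poisson_mass_eq(2) assms)
      show ?thesis
        unfolding suminf_of_real[OF sm]
        by (rule suminf_mult2[symmetric]) (rule summable_of_real[OF sm])
    qed
    also have "(\<Sum>n. lam ^ k * (real (n + k choose k) * (- lam) ^ n / Gamma (\<beta> * real (n + k) + 1)))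
        = frac_poisson_mass lam \<beta> k"
      unfolding frac_poisson_mass_eq(1)[OF assms(2)] by (intro suminf_mult frac_poisson_mass_eq(2) assms)
    finally show ?thesis .
  qed
  show "summable (\<lambda>k. norm (of_real (frac_poisson_mass lam \<beta> k) * c k))"
  proof (rule summable_comparison_test'[OF sw(2)])
    show "norm (norm (of_real (frac_poisson_mass lam \<beta> k) * c k)) \<le> (\<Sum>m. norm (f m k))" for k
      unfolding outer[symmetric] using summable_norm[OF sw(1)[of k]] by (simp only: real_norm_def abs_norm_cancel)
  qed
  show "(\<Sum>k. of_real (frac_poisson_mass lam \<beta> k) * c k) =
       (\<Sum>m. of_real (lam ^ m / Gamma (\<beta> * real m + 1)) *
          (\<Sum>k\<le>m. of_nat (m choose k) * (- 1) ^ (m - k) * c k))"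
    unfolding outer[symmetric] sw(3)[symmetric]
    by (subst inner[of "\<lambda>x. x"]) (auto simp: f_def sum_distrib_left e_def)
qed

text \<open>Vandermonde's convolution separates \<open>k\<close> from \<open>z\<close>; by binomial
  orthogonality the mean of \<open>k choose i\<close> is the single coefficient
  \<open>lam ^ i / Gamma (\<beta> * real i + 1)\<close>. In generating functions, the mean of (1 +
  w) powr (k + z) is (1 + w) powr z times the Mittag-Leffler function at
  \<open>lam * w\<close>.\<close>

lemma frac_poisson_mass_gbinomial:
  fixes z :: complex
  assumes "0 < lam" "0 < \<beta>"
  shows "(\<Sum>k. of_real (frac_poisson_mass lam \<beta> k) * ((of_nat k + z) gchoose n)) =
     (\<Sum>i\<le>n. of_real (lam ^ i / Gamma (\<beta> * real i + 1)) * (z gchoose (n - i)))"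
proof -
  have ch: "norm (of_nat (k choose i) :: complex) \<le> 1 * 2 ^ k" for k i
    using binomial_le_pow2[of k i] of_nat_le_iff[where 'a = real, of "k choose i" "2 ^ k"] by simp
  have sm: "summable (\<lambda>k. of_real (frac_poisson_mass lam \<beta> k) * (of_nat (k choose i) :: complex))" for i
    by (rule summable_norm_cancel, rule frac_poisson_mass_sum(1)[OF assms _ ch[of _ i]]) simp
  have m: "(\<Sum>k. of_real (frac_poisson_mass lam \<beta> k) * (of_nat (k choose i) :: complex)) =
       (\<Sum>m. of_real (lam ^ m / Gamma (\<beta> * real m + 1)) *
          (\<Sum>k\<le>m. of_nat (m choose k) * (- 1) ^ (m - k) * of_nat (k choose i)))" for i
    by (rule frac_poisson_mass_sum(2)[OF assms _ ch[of _ i]]) simp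
  have mi: "(\<Sum>k. of_real (frac_poisson_mass lam \<beta> k) * of_nat (k choose i))
      = (of_real (lam ^ i / Gamma (\<beta> * real i + 1)) :: complex)" for i
  proof -
    have "(\<Sum>k. of_real (frac_poisson_mass lam \<beta> k) * of_nat (k choose i))
       = (\<Sum>m. of_real (lam ^ m / Gamma (\<beta> * real m + 1)) * (if m = i then 1 else (0::complex)))"
      by (simp only: m binomial_orthogonality)
    also have "\<dots> = (\<Sum>m\<in>{i}. of_real (lam ^ m / Gamma (\<beta> * real m + 1)) * (if m = i then 1 else (0::complex)))"
      by (rule suminf_finite) auto
    finally show ?thesis by simp
  qed
  have "(\<Sum>k. of_real (frac_poisson_mass lam \<beta> k) * ((of_nat k + z) gchoose n))
     = (\<Sum>k. \<Sum>i\<le>n. of_real (frac_poisson_mass lam \<beta> k) * of_nat (k choose i) * (z gchoose (n - i)))"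
    by (intro suminf_cong)
      (simp add: gbinomial_Vandermonde[symmetric] binomial_gbinomial atLeast0AtMost sum_distrib_left mult_ac)
  also have "\<dots> = (\<Sum>i\<le>n. \<Sum>k. of_real (frac_poisson_mass lam \<beta> k) * of_nat (k choose i) * (z gchoose (n - i)))"
    by (intro suminf_sum summable_mult2 sm)
  also have "\<dots> = (\<Sum>i\<le>n. of_real (lam ^ i / Gamma (\<beta> * real i + 1)) * (z gchoose (n - i)))"
    by (intro sum.cong refl) (simp add: suminf_mult2[OF sm, symmetric] mi del: of_real_divide of_real_power)
  finally show ?thesis .
qed

section \<open>The Appell polynomials in the basis of binomial coefficients\<close>

definition mittag_leffler_fps :: "real \<Rightarrow> real \<Rightarrow> complex fps" where
  "mittag_leffler_fps lam \<beta> = Abs_fps (\<lambda>n. of_real (lam ^ n / Gamma (\<beta> * real n + 1)))"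

definition appell_coeff :: "real \<Rightarrow> real \<Rightarrow> nat \<Rightarrow> complex" where
  "appell_coeff lam \<beta> n = fps_nth (inverse (mittag_leffler_fps lam \<beta>)) n"

lemma mittag_leffler_fps_0: "fps_nth (mittag_leffler_fps lam \<beta>) 0 = 1"
  by (simp add: mittag_leffler_fps_def)

lemma mittag_leffler_has_fps_expansion:
  assumes "0 < \<beta>"
  shows "(\<lambda>z. mittag_leffler \<beta> (of_real lam * z)) has_fps_expansion mittag_leffler_fps lam \<beta>"
proof (rule has_fps_expansionI, rule always_eventually, rule allI)
  fix u :: complex
  show "(\<lambda>n. fps_nth (mittag_leffler_fps lam \<beta>) n * u ^ n) sums mittag_leffler \<beta> (of_real lam * u)"
    using summable_sums[OF summable_mittag_leffler[OF assms, of "of_real lam * u"]]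
    by (simp add: mittag_leffler_fps_def mittag_leffler_def power_mult_distrib)
qed

text \<open>The generating function is the binomial series of (1 + z) powr x times the reciprocal
  Mittag-Leffler series, so its coefficients form a Cauchy product.\<close>

lemma appell_eq:
  assumes "0 < \<beta>"
  shows "appell lam \<beta> n x = fact n * (\<Sum>i\<le>n. (x gchoose i) * appell_coeff lam \<beta> (n - i))"
proof -
  let ?M = "mittag_leffler_fps lam \<beta>"
  have "(\<lambda>z. (1 + z) powr x * inverse (mittag_leffler \<beta> (of_real lam * z))) has_fps_expansion fps_binomial x * inverse ?M"
    using mittag_leffler_fps_0[of lam \<beta>]
    by (intro fps_expansion_intros mittag_leffler_has_fps_expansion assms) auto
  \<comment> \<open>On the unit disc \<open>1 + z\<close> is nonzero, which keeps
    \<open>powr\<close> away from its default value at base 0.\<close>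
  moreover have "eventually (\<lambda>z::complex. z \<in> ball 0 1) (nhds 0)"
    by (rule eventually_nhds_in_open) auto
  then have "eventually (\<lambda>z. (1 + z) powr x * inverse (mittag_leffler \<beta> (of_real lam * z)) = appell_gen lam \<beta> x z) (nhds 0)"
  proof eventually_elim
    case (elim z)
    then have "1 + z \<noteq> 0" by (auto simp: add_eq_0_iff)
    then show ?case by (simp add: appell_gen_def powr_def divide_inverse)
  qed
  ultimately have "appell_gen lam \<beta> x has_fps_expansion fps_binomial x * inverse ?M"
    unfolding has_fps_expansion_def by (auto elim: eventually_elim2)
  from fps_nth_fps_expansion[OF this, of n] show ?thesis
    by (simp add: appell_def fps_mult_nth appell_coeff_def atLeast0AtMost field_simps)
qed

text \<open>The Mittag-Leffler series has constant term 1, so its reciprocal has a positive radius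
  of convergence, and the terms at a point inside it are bounded.\<close>

lemma appell_coeff_bound:
  assumes "0 < \<beta>"
  obtains K \<rho> where "0 < K" "0 < \<rho>" "\<And>n. norm (appell_coeff lam \<beta> n) \<le> K * \<rho> ^ n"
proof -
  have "fps_conv_radius (inverse (mittag_leffler_fps lam \<beta>)) > 0"
    using mittag_leffler_has_fps_expansion[OF assms, of lam] mittag_leffler_fps_0[of lam \<beta>]
    by (intro fps_conv_radius_inverse_pos) (auto simp: has_fps_expansion_def)
  then obtain r where r: "0 < ereal r" "ereal r < fps_conv_radius (inverse (mittag_leffler_fps lam \<beta>))"
    using ereal_dense2 by blast
  then have "summable (\<lambda>n. appell_coeff lam \<beta> n * of_real r ^ n)"
    unfolding appell_coeff_def by (intro summable_fps) auto
  then have "Bseq (\<lambda>n. appell_coeff lam \<beta> n * of_real r ^ n)"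
    by (intro convergent_imp_Bseq convergentI[OF summable_LIMSEQ_zero])
  then obtain K where K: "K > 0" "\<And>n. norm (appell_coeff lam \<beta> n * of_real r ^ n) \<le> K"
    unfolding Bseq_def by blast
  show ?thesis
  proof (rule that[of K "1 / r"])
    fix n
    show "norm (appell_coeff lam \<beta> n) \<le> K * (1 / r) ^ n"
      using K(2)[of n] r by (simp add: norm_mult norm_power field_simps)
  qed (use K r in auto)
qed

lemma norm_gbinomial_le:
  fixes x :: "'a :: real_normed_field"
  shows "norm (x gchoose j) \<le> pochhammer (norm x) j / fact j"
proof -
  have "norm (\<Prod>i = 0..<j. x - of_nat i) \<le> (\<Prod>i = 0..<j. norm x + of_nat i)"
    unfolding prod_norm[symmetric]
  proof (intro prod_mono conjI)
    fix i show "norm (x - of_nat i) \<le> norm x + of_nat i"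
      using norm_triangle_ineq4[of x "of_nat i"] by simp
  qed auto
  then show ?thesis
    by (simp add: gbinomial_prod_rev pochhammer_prod norm_divide divide_right_mono)
qed

lemma pochhammer_sums:
  fixes r \<epsilon> :: real
  assumes "0 \<le> \<epsilon>" "\<epsilon> < 1"
  shows "(\<lambda>j. pochhammer r j / fact j * \<epsilon> ^ j) sums ((1 - \<epsilon>) powr (- r))"
proof -
  have "(\<lambda>j. (- r gchoose j) * (- \<epsilon>) ^ j) sums ((1 + (- \<epsilon>)) powr (- r))"
    using assms by (intro gen_binomial_real) auto
  also have "(\<lambda>j. (- r gchoose j) * (- \<epsilon>) ^ j) = (\<lambda>j. pochhammer r j / fact j * \<epsilon> ^ j)"
  proof
    fix j
    have "(- 1 :: real) ^ j * (- 1) ^ j = 1" by (simp flip: power_mult_distrib)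
    then show "(- r gchoose j) * (- \<epsilon>) ^ j = pochhammer r j / fact j * \<epsilon> ^ j"
      unfolding gbinomial_pochhammer power_minus[of \<epsilon> j] by simp
  qed
  finally show ?thesis by simp
qed

lemma powr_neg_le_two_powr:
  fixes \<epsilon> r :: real
  assumes "0 \<le> \<epsilon>" "\<epsilon> \<le> 1 / 2" "0 \<le> r"
  shows "(1 - \<epsilon>) powr (- r) \<le> 2 powr r"
proof -
  have "(1 - \<epsilon>) powr (- r) \<le> (1 / 2) powr (- r)"
    using assms by (intro powr_mono2') auto
  also have "\<dots> = 2 powr r" by (simp add: powr_divide powr_minus)
  finally show ?thesis .
qed

text \<open>One term of the nonnegative binomial series at 1/2 is at most the whole sum, which is
  \<open>2 powr norm x\<close>.\<close>

lemma norm_gbinomial_le_powr: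
  fixes x :: "'a :: real_normed_field"
  shows "norm (x gchoose j) \<le> 2 ^ j * 2 powr norm x"
proof -
  have s: "(\<lambda>j. pochhammer (norm x) j / fact j * (1 / 2) ^ j) sums ((1 - 1 / 2) powr (- norm x))"
    by (rule pochhammer_sums) auto
  have "pochhammer (norm x) j / fact j * (1 / 2) ^ j = (\<Sum>j\<in>{j}. pochhammer (norm x) j / fact j * (1 / 2) ^ j)"
    by simp
  also have "\<dots> \<le> (1 - 1 / 2) powr (- norm x)"
    unfolding sums_unique[OF s]
    using sums_summable[OF s] by (intro sum_le_suminf) (auto simp del: times_divide_eq_left intro!: mult_nonneg_nonneg divide_nonneg_nonneg pochhammer_nonneg')
  also have "\<dots> \<le> 2 powr norm x" by (rule powr_neg_le_two_powr) auto
  finally have "pochhammer (norm x) j / fact j \<le> 2 ^ j * 2 powr norm x"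
    by (simp add: power_divide field_simps)
  then show ?thesis using norm_gbinomial_le[of x j] by linarith
qed

text \<open>The terms are dominated by the Cauchy product of a binomial series, with sum at most
  \<open>2 powr norm x\<close>, and a geometric series, with sum at most \<open>2 * K\<close>. The
  resulting growth in \<open>x\<close> is mild enough for
  \<open>frac_poisson_mass_sum\<close>.\<close>

lemma appell_series_bound:
  fixes x :: complex
  assumes "0 < \<beta>" "0 < K" "0 < \<rho>" and g: "\<And>n. norm (appell_coeff lam \<beta> n) \<le> K * \<rho> ^ n"
    and eps: "0 \<le> \<epsilon>" "\<epsilon> \<le> 1 / 2" "\<rho> * \<epsilon> \<le> 1 / 2"
  shows "summable (\<lambda>n. \<epsilon> ^ n * (norm (appell lam \<beta> n x) / fact n))"
    and "(\<Sum>n. \<epsilon> ^ n * (norm (appell lam \<beta> n x) / fact n)) \<le> 2 * K * 2 powr norm x"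
proof -
  let ?a = "\<lambda>j. pochhammer (norm x) j / fact j * \<epsilon> ^ j"
  let ?b = "\<lambda>j. K * (\<rho> * \<epsilon>) ^ j"
  have a: "?a sums ((1 - \<epsilon>) powr (- norm x))"
    using eps by (intro pochhammer_sums) auto
  have b: "?b sums (K * (1 / (1 - \<rho> * \<epsilon>)))"
    using eps assms by (intro sums_mult geometric_sums) auto
  have a0: "0 \<le> ?a j" for j using eps by (intro mult_nonneg_nonneg divide_nonneg_nonneg pochhammer_nonneg' zero_le_power) auto
  have b0: "0 \<le> ?b j" for j using eps assms by auto
  have "(\<lambda>n. \<Sum>i\<le>n. ?a i * ?b (n - i)) sums (suminf ?a * suminf ?b)"
    by (intro Cauchy_product_sums) (simp_all only: real_norm_def abs_of_nonneg[OF a0] abs_of_nonneg[OF b0] sums_summable[OF a] sums_summable[OF b])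
  then have c: "(\<lambda>n. \<Sum>i\<le>n. ?a i * ?b (n - i)) sums ((1 - \<epsilon>) powr (- norm x) * (K * (1 / (1 - \<rho> * \<epsilon>))))"
    using a b by (simp add: sums_iff)
  have le: "\<epsilon> ^ n * (norm (appell lam \<beta> n x) / fact n) \<le> (\<Sum>i\<le>n. ?a i * ?b (n - i))" for n
  proof -
    have "norm (appell lam \<beta> n x) / fact n = norm (\<Sum>i\<le>n. (x gchoose i) * appell_coeff lam \<beta> (n - i))"
      by (simp add: appell_eq[OF assms(1)] norm_mult)
    also have "\<dots> \<le> (\<Sum>i\<le>n. pochhammer (norm x) i / fact i * (K * \<rho> ^ (n - i)))"
    proof (intro sum_norm_le)
      fix i
      show "norm ((x gchoose i) * appell_coeff lam \<beta> (n - i)) \<le> pochhammer (norm x) i / fact i * (K * \<rho> ^ (n - i))"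
        unfolding norm_mult
        by (intro mult_mono norm_gbinomial_le g divide_nonneg_nonneg pochhammer_nonneg') auto
    qed
    finally have "\<epsilon> ^ n * (norm (appell lam \<beta> n x) / fact n)
        \<le> \<epsilon> ^ n * (\<Sum>i\<le>n. pochhammer (norm x) i / fact i * (K * \<rho> ^ (n - i)))"
      using eps by (intro mult_left_mono) auto
    also have "\<dots> = (\<Sum>i\<le>n. ?a i * ?b (n - i))"
      unfolding sum_distrib_left
    proof (intro sum.cong refl)
      fix i assume "i \<in> {..n}"
      then have "\<epsilon> ^ n = \<epsilon> ^ i * \<epsilon> ^ (n - i)" by (simp flip: power_add)
      then show "\<epsilon> ^ n * (pochhammer (norm x) i / fact i * (K * \<rho> ^ (n - i))) = ?a i * ?b (n - i)"
        by (simp add: power_mult_distrib)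
    qed
    finally show ?thesis .
  qed
  show s: "summable (\<lambda>n. \<epsilon> ^ n * (norm (appell lam \<beta> n x) / fact n))"
    using sums_summable[OF c] by (rule summable_comparison_test') (use le eps in auto)
  have "(\<Sum>n. \<epsilon> ^ n * (norm (appell lam \<beta> n x) / fact n)) \<le> (1 - \<epsilon>) powr (- norm x) * (K * (1 / (1 - \<rho> * \<epsilon>)))"
    unfolding sums_unique[OF c] by (intro suminf_le le s sums_summable[OF c])
  also have "\<dots> \<le> 2 powr norm x * (K * 2)"
    using eps assms by (intro mult_mono powr_neg_le_two_powr) (auto simp: field_simps)
  finally show "(\<Sum>n. \<epsilon> ^ n * (norm (appell lam \<beta> n x) / fact n)) \<le> 2 * K * 2 powr norm x"
    by (simp add: mult_ac)
qed

section \<open>The convolution as a map from Appell series to Newton series\<close>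

lemma H1_coeff_bound:
  assumes "\<phi> \<in> H1_space q"
  shows "fact n * norm (\<phi> n) \<le> H1_norm q \<phi> * ((1 / sqrt 2) ^ q) ^ n"
proof -
  let ?t = "\<lambda>n. (fact n)\<^sup>2 * 2 ^ (n * q) * (norm (\<phi> n))\<^sup>2"
  \<comment> \<open>Only one term of the sum of squares is kept; the square root turns its weight
    into a geometric factor.\<close>
  have "?t n = (\<Sum>n\<in>{n}. ?t n)" by simp
  also have "\<dots> \<le> suminf ?t"
    using assms by (intro sum_le_suminf) (auto simp: H1_space_def)
  finally have "sqrt (?t n) \<le> H1_norm q \<phi>"
    unfolding H1_norm_def by (rule real_sqrt_le_mono)
  also have "sqrt (?t n) = fact n * norm (\<phi> n) * (sqrt 2 ^ q) ^ n"
    by (simp add: real_sqrt_mult real_sqrt_power power_mult[symmetric] mult.commute)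
  finally show ?thesis
    by (simp add: power_divide field_simps)
qed

lemma H1_norm_nonneg: "\<phi> \<in> H1_space q \<Longrightarrow> 0 \<le> H1_norm q \<phi>"
  using H1_coeff_bound[of \<phi> q 0] norm_ge_zero[of "\<phi> 0"] by (simp del: norm_ge_zero)

lemma continuous_on_gbinomial [continuous_intros]:
  fixes f :: "'a :: topological_space \<Rightarrow> 'b :: real_normed_field"
  shows "continuous_on A f \<Longrightarrow> continuous_on A (\<lambda>x. f x gchoose n)"
  unfolding gbinomial_prod_rev by (intro continuous_intros) auto

definition newton_series :: "(nat \<Rightarrow> complex) \<Rightarrow> complex \<Rightarrow> complex" where
  "newton_series \<phi> z = (\<Sum>n. \<phi> n * fact n * (z gchoose n))"

text \<open>In generating functions over the index of the polynomials, averaging multiplies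
  \<open>fps_binomial z\<close> by \<open>mittag_leffler_fps\<close>, and
  \<open>appell_coeff\<close> supplies exactly the inverse factor.\<close>

lemma frac_poisson_appell:
  assumes "0 < lam" "0 < \<beta>"
  shows "(\<Sum>k. of_real (frac_poisson_mass lam \<beta> k) * appell lam \<beta> n (of_nat k + z)) = fact n * (z gchoose n)"
proof -
  let ?p = "\<lambda>k. complex_of_real (frac_poisson_mass lam \<beta> k)"
  let ?M = "mittag_leffler_fps lam \<beta>"
  have s: "summable (\<lambda>k. ?p k * ((of_nat k + z) gchoose j))" for j
  proof (rule summable_norm_cancel, rule frac_poisson_mass_sum(1)[OF assms])
    fix k
    have "norm ((of_nat k + z) gchoose j) \<le> 2 ^ j * 2 powr norm (of_nat k + z)"
      by (rule norm_gbinomial_le_powr)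
    also have "\<dots> \<le> 2 ^ j * 2 powr (real k + norm z)"
      using norm_triangle_ineq[of "of_nat k" z] by (intro mult_left_mono powr_mono) auto
    finally show "norm ((of_nat k + z) gchoose j) \<le> (2 ^ j * 2 powr norm z) * 2 ^ k"
      by (simp add: powr_add powr_realpow mult_ac)
  qed auto
  have "(\<Sum>k. ?p k * appell lam \<beta> n (of_nat k + z))
     = (\<Sum>k. \<Sum>i\<le>n. fact n * appell_coeff lam \<beta> (n - i) * (?p k * ((of_nat k + z) gchoose i)))"
    by (intro suminf_cong) (simp add: appell_eq[OF assms(2)] sum_distrib_left mult_ac)
  also have "\<dots> = (\<Sum>i\<le>n. \<Sum>k. fact n * appell_coeff lam \<beta> (n - i) * (?p k * ((of_nat k + z) gchoose i)))"
    by (intro suminf_sum summable_mult s)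
  also have "\<dots> = (\<Sum>i\<le>n. fact n * appell_coeff lam \<beta> (n - i) * (\<Sum>k. ?p k * ((of_nat k + z) gchoose i)))"
    by (intro sum.cong refl suminf_mult s)
  also have "\<dots> = (\<Sum>i\<le>n. fact n * appell_coeff lam \<beta> (n - i) * fps_nth (?M * fps_binomial z) i)"
    unfolding frac_poisson_mass_gbinomial[OF assms]
    by (simp add: fps_mult_nth mittag_leffler_fps_def atLeast0AtMost)
  also have "\<dots> = fact n * fps_nth ((?M * fps_binomial z) * inverse ?M) n"
    unfolding fps_mult_nth[of "?M * fps_binomial z"]
    by (simp add: appell_coeff_def atLeast0AtMost sum_distrib_left mult_ac)
  also have "(?M * fps_binomial z) * inverse ?M = fps_binomial z * (inverse ?M * ?M)"
    by (simp only: mult_ac)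
  also have "inverse ?M * ?M = 1"
    using mittag_leffler_fps_0[of lam \<beta>] by (intro inverse_mult_eq_1) simp
  finally show ?thesis by simp
qed

lemma inverse_sqrt2_power_small:
  assumes "0 < e"
  obtains q where "(1 / sqrt 2) ^ q \<le> e"
proof -
  have "(\<lambda>q. (1 / sqrt 2) ^ q) \<longlonglongrightarrow> 0"
    by (intro LIMSEQ_power_zero) auto
  then have "eventually (\<lambda>q. (1 / sqrt 2) ^ q < e) sequentially"
    using assms by (rule order_tendstoD)
  then show ?thesis using that less_imp_le unfolding eventually_at_top_linorder by blast
qed

text \<open>For large \<open>q\<close>, membership in \<open>H1_space q\<close> bounds the Appell
  series at \<open>k + z\<close> absolutely by a multiple of \<open>2 ^ k\<close>. The masses absorb
  this growth, so integral and series may be interchanged and \<open>frac_poisson_appell\<close>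
  applies termwise.\<close>

lemma convolution_eq_newton_series:
  assumes "0 < lam" "0 < \<beta>" "\<beta> \<le> 1" and \<phi>: "\<phi> \<in> N1_space"
  shows "integrable (frac_poisson lam \<beta>) (\<lambda>x. series_eval lam \<beta> \<phi> (of_real x + z))"
    and "convolution lam \<beta> \<phi> z = newton_series \<phi> z"
proof -
  let ?p = "frac_poisson_mass lam \<beta>"
  obtain K \<rho> where K: "0 < K" "0 < \<rho>" "\<And>n. norm (appell_coeff lam \<beta> n) \<le> K * \<rho> ^ n"
    using appell_coeff_bound[OF assms(2)] by blast
  \<comment> \<open>The two bounds are what \<open>appell_series_bound\<close> asks of
    \<epsilon>.\<close>
  obtain q where q: "(1 / sqrt 2) ^ q \<le> min (1 / 2) (1 / (2 * \<rho>))"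
    using K by (elim inverse_sqrt2_power_small[rotated]) auto
  define \<epsilon> where "\<epsilon> = (1 / sqrt 2) ^ q"
  have eps: "0 \<le> \<epsilon>" "\<epsilon> \<le> 1 / 2" "\<rho> * \<epsilon> \<le> 1 / 2"
    using q K by (auto simp: \<epsilon>_def field_simps)
  have \<phi>q: "\<phi> \<in> H1_space q" using \<phi> by (auto simp: N1_space_def)
  define N where "N = H1_norm q \<phi>"
  have N: "0 \<le> N" unfolding N_def by (rule H1_norm_nonneg[OF \<phi>q])
  note ab = appell_series_bound[OF assms(2) K eps]
  have tb: "norm (\<phi> n * appell lam \<beta> n x) \<le> N * (\<epsilon> ^ n * (norm (appell lam \<beta> n x) / fact n))" for n x
  proof -
    have "norm (\<phi> n * appell lam \<beta> n x) = (fact n * norm (\<phi> n)) * (norm (appell lam \<beta> n x) / fact n)"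
      by (simp add: norm_mult)
    also have "\<dots> \<le> (N * \<epsilon> ^ n) * (norm (appell lam \<beta> n x) / fact n)"
      unfolding N_def \<epsilon>_def by (intro mult_right_mono H1_coeff_bound[OF \<phi>q]) auto
    finally show ?thesis by (simp add: mult_ac)
  qed
  have s: "summable (\<lambda>n. norm (\<phi> n * appell lam \<beta> n x))" for x
    by (rule summable_comparison_test'[OF summable_mult[OF ab(1), of N x]]) (use tb in auto)
  have sb: "(\<Sum>n. norm (\<phi> n * appell lam \<beta> n x)) \<le> N * (2 * K * 2 powr norm x)" for x
  proof -
    have "(\<Sum>n. norm (\<phi> n * appell lam \<beta> n x)) \<le> (\<Sum>n. N * (\<epsilon> ^ n * (norm (appell lam \<beta> n x) / fact n)))"
      by (intro suminf_le tb s summable_mult ab)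
    also have "\<dots> = N * (\<Sum>n. \<epsilon> ^ n * (norm (appell lam \<beta> n x) / fact n))"
      by (intro suminf_mult ab)
    also have "\<dots> \<le> N * (2 * K * 2 powr norm x)"
      by (intro mult_left_mono ab N)
    finally show ?thesis .
  qed
  define C where "C = N * 2 * K * 2 powr norm z"
  have sbk: "(\<Sum>n. norm (\<phi> n * appell lam \<beta> n (of_nat k + z))) \<le> C * 2 ^ k" for k
  proof -
    note sb[of "of_nat k + z"]
    also have "N * (2 * K * 2 powr norm (of_nat k + z)) \<le> N * (2 * K * 2 powr (real k + norm z))"
      using norm_triangle_ineq[of "of_nat k" z] N K by (intro mult_left_mono powr_mono) auto
    finally show ?thesis by (simp add: C_def powr_add powr_realpow mult_ac)
  qed
  have "continuous_on UNIV (\<lambda>x. appell lam \<beta> n (of_real x + z))" for n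
    unfolding appell_eq[OF assms(2)] by (intro continuous_intros)
  then have [measurable]: "(\<lambda>x. appell lam \<beta> n (of_real x + z)) \<in> borel_measurable borel" for n
    by (rule borel_measurable_continuous_onI)
  have meas: "(\<lambda>x. series_eval lam \<beta> \<phi> (of_real x + z)) \<in> borel_measurable borel"
    unfolding series_eval_def by measurable
  have cb: "norm (series_eval lam \<beta> \<phi> (of_real (real k) + z)) \<le> C * 2 ^ k" for k
  proof -
    have "norm (series_eval lam \<beta> \<phi> (of_nat k + z)) \<le> (\<Sum>n. norm (\<phi> n * appell lam \<beta> n (of_nat k + z)))"
      unfolding series_eval_def by (rule summable_norm[OF s])
    also note sbk[of k]
    finally show ?thesis by simp
  qed
  have sm: "summable (\<lambda>k. norm (of_real (?p k) * series_eval lam \<beta> \<phi> (of_real (real k) + z)))"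
    by (rule frac_poisson_mass_sum(1)[OF assms(1,2) _ cb]) simp
  have nn: "0 \<le> lam" using assms by simp
  show "integrable (frac_poisson lam \<beta>) (\<lambda>x. series_eval lam \<beta> \<phi> (of_real x + z))"
    by (rule frac_poisson_integral(1)[OF nn assms(2,3) meas sm])
  define f where "f = (\<lambda>k n. of_real (?p k) * (\<phi> n * appell lam \<beta> n (of_nat k + z)))"
  have f1: "summable (\<lambda>n. norm (f k n))" for k
    unfolding f_def by (subst norm_mult) (intro summable_mult s)
  have f2: "summable (\<lambda>k. \<Sum>n. norm (f k n))"
  proof (rule summable_comparison_test')
    show "summable (\<lambda>k. norm (complex_of_real (?p k) * of_real (C * 2 ^ k)))"
    proof (rule frac_poisson_mass_sum(1)[OF assms(1,2)])
      show "norm (complex_of_real (C * 2 ^ k)) \<le> C * 2 ^ k" for k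
        using N K by (simp add: C_def norm_mult norm_power abs_mult)
    qed simp
    fix k
    have "(\<Sum>n. norm (f k n)) = \<bar>?p k\<bar> * (\<Sum>n. norm (\<phi> n * appell lam \<beta> n (of_nat k + z)))"
      unfolding f_def norm_mult[of "of_real (?p k)"] by (subst suminf_mult[OF s]) simp
    also have "\<dots> \<le> \<bar>?p k\<bar> * (C * 2 ^ k)" by (intro mult_left_mono sbk) auto
    also have "\<dots> \<le> norm (complex_of_real (?p k) * of_real (C * 2 ^ k))"
      unfolding norm_mult norm_of_real by (intro mult_left_mono) auto
    finally show "norm (\<Sum>n. norm (f k n)) \<le> norm (complex_of_real (?p k) * of_real (C * 2 ^ k))"
      using suminf_nonneg[OF f1[of k]] by simp
  qed
  note sw = double_series_swap[of f, OF f1 f2]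
  have "convolution lam \<beta> \<phi> z = (\<Sum>k. of_real (?p k) * series_eval lam \<beta> \<phi> (of_real (real k) + z))"
    unfolding convolution_def by (rule frac_poisson_integral(2)[OF nn assms(2,3) meas sm])
  also have "\<dots> = (\<Sum>k. \<Sum>n. f k n)"
    unfolding f_def series_eval_def
    by (intro suminf_cong) (simp add: suminf_mult[OF summable_norm_cancel[OF s]])
  also have "\<dots> = (\<Sum>n. \<Sum>k. f k n)" by (rule sw(3))
  also have "\<dots> = newton_series \<phi> z"
    unfolding newton_series_def
  proof (intro suminf_cong)
    fix n
    show "(\<Sum>k. f k n) = \<phi> n * fact n * (z gchoose n)"
    \<comment> \<open>Summability over \<open>k\<close> of the averaged polynomial is recovered from
      that of \<open>f\<close> by dividing by \<open>\<phi> n\<close>; for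
      \<open>\<phi> n = 0\<close> both sides vanish.\<close>
    proof (cases "\<phi> n = 0")
      case False
      have "summable (\<lambda>k. \<phi> n * (of_real (?p k) * appell lam \<beta> n (of_nat k + z)))"
        using summable_norm_cancel[OF sw(1)[of n]] by (simp add: f_def mult_ac)
      then have sa: "summable (\<lambda>k. of_real (?p k) * appell lam \<beta> n (of_nat k + z))"
        using False by (subst (asm) summable_cmult_iff) simp
      have "(\<Sum>k. f k n) = (\<Sum>k. \<phi> n * (of_real (?p k) * appell lam \<beta> n (of_nat k + z)))"
        by (simp add: f_def mult_ac)
      also have "\<dots> = \<phi> n * (\<Sum>k. of_real (?p k) * appell lam \<beta> n (of_nat k + z))"
        by (rule suminf_mult[OF sa])
      finally show ?thesis by (simp add: frac_poisson_appell[OF assms(1,2)])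
    qed (simp add: f_def)
  qed
  finally show "convolution lam \<beta> \<phi> z = newton_series \<phi> z" .
qed

subsection \<open>Newton series of entire functions of minimal type\<close>

lemma inverse_sqrt2_power_lt_1:
  "0 < q \<Longrightarrow> (1 / sqrt 2) ^ q < (1 :: real)"
  by (simp add: power_divide)

text \<open>A positive \<open>q\<close> makes \<epsilon> less than 1, so the binomial series of (1 -
  \<epsilon>) powr (- |z|) majorizes the Newton series.\<close>

lemma newton_series_bound:
  assumes \<phi>: "\<phi> \<in> H1_space q" and q: "0 < q"
  defines "\<epsilon> \<equiv> (1 / sqrt 2) ^ q"
  shows "norm (\<phi> n * fact n * (z gchoose n)) \<le> H1_norm q \<phi> * (pochhammer (norm z) n / fact n * \<epsilon> ^ n)"
    and "summable (\<lambda>n. norm (\<phi> n * fact n * (z gchoose n)))"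
    and "norm (newton_series \<phi> z) \<le> H1_norm q \<phi> * (1 - \<epsilon>) powr (- norm z)"
proof -
  have eps: "0 \<le> \<epsilon>" "\<epsilon> < 1" using inverse_sqrt2_power_lt_1[OF q] by (auto simp: \<epsilon>_def)
  have p: "(\<lambda>n. pochhammer (norm z) n / fact n * \<epsilon> ^ n) sums (1 - \<epsilon>) powr (- norm z)"
    by (rule pochhammer_sums[OF eps])
  show le: "norm (\<phi> n * fact n * (z gchoose n)) \<le> H1_norm q \<phi> * (pochhammer (norm z) n / fact n * \<epsilon> ^ n)" for n
  proof -
    have "norm (\<phi> n * fact n * (z gchoose n)) = (fact n * norm (\<phi> n)) * norm (z gchoose n)"
      by (simp add: norm_mult)
    also have "\<dots> \<le> (H1_norm q \<phi> * \<epsilon> ^ n) * (pochhammer (norm z) n / fact n)"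
      unfolding \<epsilon>_def using H1_norm_nonneg[OF \<phi>]
      by (intro mult_mono H1_coeff_bound[OF \<phi>] norm_gbinomial_le) auto
    finally show ?thesis by (simp add: mult_ac)
  qed
  have s: "summable (\<lambda>n. H1_norm q \<phi> * (pochhammer (norm z) n / fact n * \<epsilon> ^ n))"
    using sums_summable[OF p] by (rule summable_mult)
  show sn: "summable (\<lambda>n. norm (\<phi> n * fact n * (z gchoose n)))"
    using s by (rule summable_comparison_test') (use le in auto)
  have "norm (newton_series \<phi> z) \<le> (\<Sum>n. norm (\<phi> n * fact n * (z gchoose n)))"
    unfolding newton_series_def by (rule summable_norm[OF sn])
  also have "\<dots> \<le> (\<Sum>n. H1_norm q \<phi> * (pochhammer (norm z) n / fact n * \<epsilon> ^ n))"
    by (intro suminf_le le sn s)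
  also have "\<dots> = H1_norm q \<phi> * (1 - \<epsilon>) powr (- norm z)"
    using suminf_mult[OF sums_summable[OF p]] sums_unique[OF p] by simp
  finally show "norm (newton_series \<phi> z) \<le> H1_norm q \<phi> * (1 - \<epsilon>) powr (- norm z)" .
qed

text \<open>The partial sums are polynomials, and rising factorials increase with their base, so on
  a closed unit disc around \<open>x\<close> the majorant for \<open>norm x + 1\<close> allows the
  Weierstrass test.\<close>

lemma newton_series_holomorphic:
  assumes \<phi>: "\<phi> \<in> H1_space q" and q: "0 < q"
  shows "newton_series \<phi> holomorphic_on UNIV"
proof (rule holomorphic_uniform_sequence)
  fix N show "(\<lambda>z. \<Sum>n<N. \<phi> n * fact n * (z gchoose n)) holomorphic_on UNIV"
    unfolding gbinomial_prod_rev by (intro holomorphic_intros) auto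
next
  fix x :: complex
  let ?\<epsilon> = "(1 / sqrt 2) ^ q :: real"
  let ?M = "\<lambda>n. H1_norm q \<phi> * (pochhammer (norm x + 1) n / fact n * ?\<epsilon> ^ n)"
  have "uniform_limit (cball x 1) (\<lambda>N z. \<Sum>n<N. \<phi> n * fact n * (z gchoose n))
      (\<lambda>z. \<Sum>n. \<phi> n * fact n * (z gchoose n)) sequentially"
  proof (rule Weierstrass_m_test)
    show "summable ?M"
      using inverse_sqrt2_power_lt_1[OF q] sums_summable[OF pochhammer_sums[of ?\<epsilon> "norm x + 1"]]
      by (intro summable_mult) auto
    fix n z assume "z \<in> cball x 1"
    then have z: "norm z \<le> norm x + 1"
      using norm_triangle_ineq2[of z x] by (simp add: dist_norm norm_minus_commute)
    have "pochhammer (norm z) n \<le> pochhammer (norm x + 1) n"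
      unfolding pochhammer_prod using z by (intro prod_mono) auto
    then have "pochhammer (norm z) n / fact n * ?\<epsilon> ^ n \<le> pochhammer (norm x + 1) n / fact n * ?\<epsilon> ^ n"
      by (intro mult_right_mono divide_right_mono) auto
    then have "H1_norm q \<phi> * (pochhammer (norm z) n / fact n * ?\<epsilon> ^ n) \<le> ?M n"
      by (rule mult_left_mono[OF _ H1_norm_nonneg[OF \<phi>]])
    then show "norm (\<phi> n * fact n * (z gchoose n)) \<le> ?M n"
      using newton_series_bound(1)[OF \<phi> q, of n z] by linarith
  qed
  then show "\<exists>d>0. cball x d \<subseteq> UNIV \<and>
     uniform_limit (cball x d) (\<lambda>N z. \<Sum>n<N. \<phi> n * fact n * (z gchoose n)) (newton_series \<phi>) sequentially"
    unfolding newton_series_def[abs_def] by (intro exI[of _ 1]) auto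
qed simp

section \<open>Estimates for the two families of norms\<close>

lemma E1_spaceI:
  assumes "u holomorphic_on UNIV" "\<And>z. norm (u z) \<le> B * exp (norm z / 2 ^ l)"
  shows "u \<in> E1_space l" "E1_norm l u \<le> B"
proof -
  have le: "norm (u z) * exp (- (norm z / 2 ^ l)) \<le> B" for z
    using assms(2)[of z] by (simp add: exp_minus field_simps)
  show "u \<in> E1_space l"
    unfolding E1_space_def using assms(1) le by (auto intro!: bdd_aboveI2)
  show "E1_norm l u \<le> B"
    unfolding E1_norm_def using le by (intro cSUP_least) auto
qed

lemma E1_norm_bound:
  assumes "u \<in> E1_space l"
  shows "norm (u z) \<le> E1_norm l u * exp (norm z / 2 ^ l)"
proof -
  have "norm (u z) * exp (- (norm z / 2 ^ l)) \<le> E1_norm l u"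
    unfolding E1_norm_def using assms by (intro cSUP_upper) (auto simp: E1_space_def)
  then show ?thesis by (simp add: exp_minus field_simps)
qed

lemma E1_norm_nonneg: "u \<in> E1_space l \<Longrightarrow> 0 \<le> E1_norm l u"
  using E1_norm_bound[of u l 0] norm_ge_zero[of "u 0"] by (simp del: norm_ge_zero)

lemma E1_diff:
  assumes "u \<in> E1_space l" "v \<in> E1_space l"
  shows "(\<lambda>z. u z - v z) \<in> E1_space l" "E1_norm l (\<lambda>z. u z - v z) \<le> E1_norm l u + E1_norm l v"
proof -
  have h: "(\<lambda>z. u z - v z) holomorphic_on UNIV"
    using assms by (auto simp: E1_space_def intro!: holomorphic_intros)
  have le: "norm (u z - v z) \<le> (E1_norm l u + E1_norm l v) * exp (norm z / 2 ^ l)" for z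
    using norm_triangle_ineq4[of "u z" "v z"] E1_norm_bound[OF assms(1), of z] E1_norm_bound[OF assms(2), of z]
    by (simp add: distrib_right)
  show "(\<lambda>z. u z - v z) \<in> E1_space l" "E1_norm l (\<lambda>z. u z - v z) \<le> E1_norm l u + E1_norm l v"
    using E1_spaceI[OF h le] by auto
qed

text \<open>The norm is a weighted l2 norm: Minkowski's inequality for the partial sums, with the
  weights moved into \<open>w\<close>, gives both membership and the triangle inequality.\<close>

lemma H1_diff:
  assumes "\<phi> \<in> H1_space q" "\<psi> \<in> H1_space q"
  shows "(\<lambda>n. \<phi> n - \<psi> n) \<in> H1_space q" "H1_norm q (\<lambda>n. \<phi> n - \<psi> n) \<le> H1_norm q \<phi> + H1_norm q \<psi>"
proof -
  define w where "w = (\<lambda>\<phi> n. fact n * sqrt 2 ^ (n * q) * norm (\<phi> n :: complex))"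
  have w: "(w \<phi> n)\<^sup>2 = (fact n)\<^sup>2 * 2 ^ (n * q) * (norm (\<phi> n))\<^sup>2" for \<phi> n
  proof -
    have "(sqrt 2 ^ (n * q))\<^sup>2 = (2 :: real) ^ (n * q)"
      by (metis power_commutes power_mult real_sqrt_pow2 zero_le_numeral mult.commute)
    then show ?thesis by (simp add: w_def power_mult_distrib)
  qed
  have w0: "0 \<le> w \<phi> n" for \<phi> n by (simp add: w_def)
  have sp: "\<phi> \<in> H1_space q \<longleftrightarrow> summable (\<lambda>n. (w \<phi> n)\<^sup>2)" for \<phi>
    by (simp add: H1_space_def w)
  have nm: "H1_norm q \<phi> = sqrt (\<Sum>n. (w \<phi> n)\<^sup>2)" for \<phi>
    by (simp add: H1_norm_def w)
  have L2: "L2_set (w \<phi>) {..<N} \<le> H1_norm q \<phi>" if "\<phi> \<in> H1_space q" for \<phi> N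
    unfolding L2_set_def nm using that by (intro real_sqrt_le_mono sum_le_suminf) (auto simp: sp)
  let ?d = "\<lambda>n. \<phi> n - \<psi> n"
  have part: "(\<Sum>n<N. (w ?d n)\<^sup>2) \<le> (H1_norm q \<phi> + H1_norm q \<psi>)\<^sup>2" for N
  proof -
    have "w ?d n \<le> w \<phi> n + w \<psi> n" for n
      unfolding w_def distrib_left[symmetric] by (intro mult_left_mono norm_triangle_ineq4) auto
    then have "L2_set (w ?d) {..<N} \<le> L2_set (\<lambda>n. w \<phi> n + w \<psi> n) {..<N}"
      by (intro L2_set_mono w0)
    also have "\<dots> \<le> L2_set (w \<phi>) {..<N} + L2_set (w \<psi>) {..<N}" by (rule L2_set_triangle_ineq)
    also have "\<dots> \<le> H1_norm q \<phi> + H1_norm q \<psi>" by (intro add_mono L2 assms)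
    finally have "(L2_set (w ?d) {..<N})\<^sup>2 \<le> (H1_norm q \<phi> + H1_norm q \<psi>)\<^sup>2"
      by (intro power_mono L2_set_nonneg)
    then show ?thesis by (simp add: L2_set_def sum_nonneg)
  qed
  have s: "summable (\<lambda>n. (w ?d n)\<^sup>2)"
    by (rule summableI_nonneg_bounded[OF _ part]) simp
  then show "?d \<in> H1_space q" by (simp add: sp)
  have "H1_norm q ?d \<le> sqrt ((H1_norm q \<phi> + H1_norm q \<psi>)\<^sup>2)"
    unfolding nm[of ?d] by (intro real_sqrt_le_mono suminf_le_const s part)
  also have "\<dots> = H1_norm q \<phi> + H1_norm q \<psi>"
    using assms by (simp add: H1_norm_nonneg)
  finally show "H1_norm q ?d \<le> H1_norm q \<phi> + H1_norm q \<psi>" .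
qed

text \<open>With \<open>q\<close> so large that 1 - \<epsilon> is at least exp (- 1 / 2^l), the
  factor (1 - \<epsilon>) powr (- |z|) is at most exp (|z| / 2^l).\<close>

lemma newton_series_E1:
  obtains q where "0 < q" "\<And>\<phi>. \<phi> \<in> H1_space q \<Longrightarrow> newton_series \<phi> \<in> E1_space l \<and> E1_norm l (newton_series \<phi>) \<le> H1_norm q \<phi>"
proof -
  have e1: "exp (- (1 / 2 ^ l)) < (1 :: real)" by simp
  then have "0 < 1 - exp (- (1 / 2 ^ l) :: real)" by simp
  then obtain q where q: "(1 / sqrt 2) ^ q \<le> 1 - exp (- (1 / 2 ^ l) :: real)"
    by (rule inverse_sqrt2_power_small)
  have q0: "0 < q"
  proof (rule ccontr)
    assume "\<not> 0 < q"
    then have "1 \<le> 1 - exp (- (1 / 2 ^ l) :: real)" using q by simp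
    then have "exp (- (1 / 2 ^ l) :: real) \<le> 0" by linarith
    then show False using exp_gt_zero[of "- (1 / 2 ^ l) :: real"] by linarith
  qed
  show ?thesis
  proof (rule that[OF q0])
    fix \<phi> assume \<phi>: "\<phi> \<in> H1_space q"
    have "norm (newton_series \<phi> z) \<le> H1_norm q \<phi> * exp (norm z / 2 ^ l)" for z
    proof -
      have "(1 - (1 / sqrt 2) ^ q) powr (- norm z) \<le> exp (- (1 / 2 ^ l)) powr (- norm z)"
        using q by (intro powr_mono2') auto
      also have "\<dots> = exp (norm z / 2 ^ l)" by (simp add: powr_def)
      finally have "H1_norm q \<phi> * (1 - (1 / sqrt 2) ^ q) powr (- norm z) \<le> H1_norm q \<phi> * exp (norm z / 2 ^ l)"
        by (rule mult_left_mono[OF _ H1_norm_nonneg[OF \<phi>]])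
      then show ?thesis using newton_series_bound(3)[OF \<phi> q0, of z] by linarith
    qed
    then show "newton_series \<phi> \<in> E1_space l \<and> E1_norm l (newton_series \<phi>) \<le> H1_norm q \<phi>"
      using E1_spaceI[OF newton_series_holomorphic[OF \<phi> q0]] by blast
  qed
qed

section \<open>The inverse map: forward differences and Stirling numbers\<close>

text \<open>The n-th forward difference of \<open>u\<close> at 0 divided by n!, that is, the
  coefficient of Newton interpolation at the nodes 0, 1, 2 and so on.\<close>

definition newton_coeff :: "(complex \<Rightarrow> complex) \<Rightarrow> nat \<Rightarrow> complex" where
  "newton_coeff u n = (\<Sum>j\<le>n. of_nat (n choose j) * (- 1) ^ (n - j) * u (of_nat j)) / fact n"

text \<open>At a natural number \<open>j\<close> the Newton series stops at index \<open>j\<close>,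
  so its values there are finite binomial sums that binomial inversion undoes.\<close>

lemma newton_coeff_newton_series: "newton_coeff (newton_series \<phi>) = \<phi>"
proof
  fix n
  have N: "newton_series \<phi> (of_nat j) = (\<Sum>m\<le>n. \<phi> m * fact m * of_nat (j choose m))" if "j \<le> n" for j
    unfolding newton_series_def
    using that by (subst suminf_finite[of "{..n}"]) (auto simp: binomial_gbinomial[symmetric] binomial_eq_0)
  have "fact n * newton_coeff (newton_series \<phi>) n
      = (\<Sum>j\<le>n. of_nat (n choose j) * (- 1) ^ (n - j) * (\<Sum>m\<le>n. \<phi> m * fact m * of_nat (j choose m)))"
    by (simp add: newton_coeff_def N)
  also have "\<dots> = (\<Sum>j\<le>n. \<Sum>m\<le>n. \<phi> m * fact m * (of_nat (n choose j) * (- 1) ^ (n - j) * of_nat (j choose m)))"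
    by (simp add: sum_distrib_left mult_ac)
  also have "\<dots> = (\<Sum>m\<le>n. \<phi> m * fact m * (\<Sum>j\<le>n. of_nat (n choose j) * (- 1) ^ (n - j) * of_nat (j choose m)))"
    by (subst sum.swap) (simp add: sum_distrib_left)
  also have "\<dots> = \<phi> n * fact n"
    by (simp add: binomial_orthogonality if_distrib[of "\<lambda>x. _ * x"] cong: if_cong)
  finally show "newton_coeff (newton_series \<phi>) n = \<phi> n" by simp
qed

text \<open>Change of basis from powers to falling factorials \<open>B n\<close>: the rule
  \<open>z * B n = of_nat n * B n + B (Suc n)\<close> matches the recurrence of the Stirling
  numbers.\<close>

lemma power_eq_sum_Stirling:
  fixes z :: "'a :: field_char_0"
  shows "z ^ k = (\<Sum>n\<le>k. of_nat (Stirling k n) * (fact n * (z gchoose n)))"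
proof (induction k)
  case (Suc k)
  define B where "B = (\<lambda>n. fact n * (z gchoose n))"
  have B: "z * B n = of_nat n * B n + B (Suc n)" for n
  proof -
    have "z * B n = fact n * (z * (z gchoose n))" by (simp add: B_def)
    also have "\<dots> = of_nat n * B n + B (Suc n)"
      unfolding gbinomial_mult_1 by (simp add: B_def algebra_simps)
    finally show ?thesis .
  qed
  \<comment> \<open>The index is shifted by one: the term at 0 has the factor 0, and the added top
    term vanishes because \<open>Stirling k (Suc k)\<close> is 0.\<close>
  have sh: "(\<Sum>n\<le>k. of_nat (n * Stirling k n) * B n) = (\<Sum>n\<le>k. of_nat (Suc n * Stirling k (Suc n)) * B (Suc n))"
  proof -
    have "(\<Sum>n\<le>k. of_nat (n * Stirling k n) * B n) = (\<Sum>n\<le>Suc k. of_nat (n * Stirling k n) * B n)"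
      by simp
    also have "\<dots> = (\<Sum>n\<le>k. of_nat (Suc n * Stirling k (Suc n)) * B (Suc n))"
      by (subst sum.atMost_Suc_shift) simp
    finally show ?thesis .
  qed
  have "z ^ Suc k = (\<Sum>n\<le>k. of_nat (Stirling k n) * (z * B n))"
    using Suc by (simp add: B_def sum_distrib_left mult_ac)
  also have "\<dots> = (\<Sum>n\<le>k. of_nat (n * Stirling k n) * B n) + (\<Sum>n\<le>k. of_nat (Stirling k n) * B (Suc n))"
    by (simp add: B distrib_left sum.distrib mult_ac)
  also have "\<dots> = (\<Sum>n\<le>k. of_nat (Stirling (Suc k) (Suc n)) * B (Suc n))"
    unfolding sh by (simp add: sum.distrib distrib_right)
  also have "\<dots> = (\<Sum>n\<le>Suc k. of_nat (Stirling (Suc k) n) * B n)"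
    by (subst sum.atMost_Suc_shift) simp
  finally show ?case by (simp add: B_def)
qed simp

text \<open>Binomial inversion of the previous expansion; the right-hand side is the
  \<open>n\<close>-th forward difference of the \<open>k\<close>-th power at 0.\<close>

lemma fact_Stirling_eq_sum:
  "fact n * of_nat (Stirling k n) =
     (\<Sum>j\<le>n. of_nat (n choose j) * (- 1) ^ (n - j) * (of_nat j :: 'a :: field_char_0) ^ k)"
proof -
  have "(\<Sum>j\<le>n. of_nat (n choose j) * (- 1) ^ (n - j) * (of_nat j :: 'a) ^ k)
      = (\<Sum>j\<le>n. \<Sum>m\<le>k. of_nat (Stirling k m) * fact m * (of_nat (n choose j) * (- 1) ^ (n - j) * of_nat (j choose m)))"
    by (subst power_eq_sum_Stirling) (simp add: sum_distrib_left binomial_gbinomial mult_ac)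
  also have "\<dots> = (\<Sum>m\<le>k. of_nat (Stirling k m) * fact m * (\<Sum>j\<le>n. of_nat (n choose j) * (- 1) ^ (n - j) * of_nat (j choose m)))"
    by (subst sum.swap) (simp add: sum_distrib_left)
  also have "\<dots> = fact n * of_nat (Stirling k n)"
    by (simp add: binomial_orthogonality if_distrib[of "\<lambda>x. _ * x"] cong: if_cong)
  finally show ?thesis ..
qed

text \<open>Summing the alternating formula over \<open>k\<close> turns the powers of
  \<open>j\<close> into exp (j t), and the binomial theorem collects these.\<close>

lemma Stirling_egf_sums:
  fixes t :: real
  shows "(\<lambda>k. fact n * real (Stirling k n) * t ^ k / fact k) sums ((exp t - 1) ^ n)"
proof -
  have "(\<lambda>k. \<Sum>j\<le>n. real (n choose j) * (- 1) ^ (n - j) * ((real j * t) ^ k /\<^sub>R fact k))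
      sums (\<Sum>j\<le>n. real (n choose j) * (- 1) ^ (n - j) * exp (real j * t))"
    by (intro sums_sum sums_mult exp_converges)
  also have "(\<lambda>k. \<Sum>j\<le>n. real (n choose j) * (- 1) ^ (n - j) * ((real j * t) ^ k /\<^sub>R fact k))
      = (\<lambda>k. fact n * real (Stirling k n) * t ^ k / fact k)"
    unfolding fact_Stirling_eq_sum sum_distrib_right sum_divide_distrib
    by (simp add: power_mult_distrib divide_inverse mult_ac)
  also have "(\<Sum>j\<le>n. real (n choose j) * (- 1) ^ (n - j) * exp (real j * t)) = (exp t + (- 1)) ^ n"
    unfolding binomial_ring exp_of_nat_mult by (simp add: mult_ac)
  finally show ?thesis by simp
qed

lemma E1_taylor_bound:
  assumes "u \<in> E1_space l"
  shows "norm ((deriv ^^ k) u 0) \<le> E1_norm l u * (exp 1 / 2 ^ l) ^ k"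
proof (cases "k = 0")
  case True
  then show ?thesis using E1_norm_bound[OF assms, of 0] by simp
next
  case False
  \<comment> \<open>This radius minimises exp (r / 2^l) / r^k in Cauchy's estimate; it is positive
    only for positive \<open>k\<close>, hence the case distinction.\<close>
  define r :: real where "r = real k * 2 ^ l"
  have r: "r > 0" using False by (simp add: r_def)
  have h: "u holomorphic_on UNIV" using assms by (simp add: E1_space_def)
  have "norm ((deriv ^^ k) u 0) \<le> fact k * (E1_norm l u * exp (real k)) / r ^ k"
  proof (rule Cauchy_inequality)
    show "u holomorphic_on ball 0 r" using h by (rule holomorphic_on_subset) simp
    show "continuous_on (cball 0 r) u"
      using h by (meson holomorphic_on_imp_continuous_on holomorphic_on_subset subset_UNIV)
    fix x :: complex assume "norm (0 - x) = r"
    then show "norm (u x) \<le> E1_norm l u * exp (real k)"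
      using E1_norm_bound[OF assms, of x] by (simp add: r_def)
  qed (rule r)
  also have "\<dots> = E1_norm l u * (exp 1 / 2 ^ l) ^ k * (fact k / real k ^ k)"
    using False by (simp add: r_def power_mult_distrib power_divide exp_of_nat_mult[of k 1, simplified] field_simps)
  also have "\<dots> \<le> E1_norm l u * (exp 1 / 2 ^ l) ^ k * 1"
  proof (intro mult_left_mono)
    have "(fact k :: real) \<le> real k ^ k" by (metis fact_le_power of_nat_fact of_nat_le_iff of_nat_power order_refl)
    then show "fact k / real k ^ k \<le> 1" using False by simp
  qed (simp add: E1_norm_nonneg[OF assms])
  finally show ?thesis by simp
qed

text \<open>Taking the \<open>n\<close>-th forward difference of the Taylor series termwise turns
  the \<open>k\<close>-th power into n! times a Stirling number. By \<open>E1_taylor_bound\<close>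
  the result is dominated by the Stirling generating function at
  \<open>exp 1 / 2 ^ l\<close>.\<close>

lemma E1_taylor_Stirling:
  assumes u: "u \<in> E1_space l" and a_def: "a = (\<lambda>k. (deriv ^^ k) u 0 / fact k)"
  defines "\<eta> \<equiv> exp (exp 1 / 2 ^ l) - 1"
  shows "summable (\<lambda>k. norm (a k * (fact n * of_nat (Stirling k n))))"
    and "(\<Sum>k. norm (a k * (fact n * of_nat (Stirling k n)))) \<le> E1_norm l u * \<eta> ^ n"
    and "fact n * newton_coeff u n = (\<Sum>k. a k * (fact n * of_nat (Stirling k n)))"
proof -
  let ?t = "exp 1 / 2 ^ l :: real"
  have e: "(\<lambda>k. E1_norm l u * (fact n * real (Stirling k n) * ?t ^ k / fact k)) sums (E1_norm l u * \<eta> ^ n)"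
    unfolding \<eta>_def by (intro sums_mult Stirling_egf_sums)
  have le: "norm (a k * (fact n * of_nat (Stirling k n))) \<le> E1_norm l u * (fact n * real (Stirling k n) * ?t ^ k / fact k)" for k
  proof -
    have "norm (a k * (fact n * of_nat (Stirling k n))) = norm ((deriv ^^ k) u 0) * (fact n * real (Stirling k n) / fact k)"
      by (simp add: a_def norm_mult norm_divide)
    also have "\<dots> \<le> (E1_norm l u * ?t ^ k) * (fact n * real (Stirling k n) / fact k)"
      by (intro mult_right_mono E1_taylor_bound u) auto
    finally show ?thesis by (simp add: mult_ac)
  qed
  show s: "summable (\<lambda>k. norm (a k * (fact n * of_nat (Stirling k n))))"
    using sums_summable[OF e] by (rule summable_comparison_test') (use le in auto)
  show "(\<Sum>k. norm (a k * (fact n * of_nat (Stirling k n)))) \<le> E1_norm l u * \<eta> ^ n"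
    unfolding sums_unique[OF e] by (intro suminf_le le s sums_summable[OF e])
  have h: "u holomorphic_on ball 0 r" for r
    using u by (auto simp: E1_space_def intro: holomorphic_on_subset)
  have t: "(\<lambda>k. a k * z ^ k) sums u z" for z
    using holomorphic_power_series[OF h[of "norm z + 1"], of z] by (simp add: a_def)
  have "(\<lambda>k. \<Sum>j\<le>n. of_nat (n choose j) * (- 1) ^ (n - j) * (a k * of_nat j ^ k))
      sums (\<Sum>j\<le>n. of_nat (n choose j) * (- 1) ^ (n - j) * u (of_nat j))"
    by (intro sums_sum sums_mult t)
  also have "(\<lambda>k. \<Sum>j\<le>n. of_nat (n choose j) * (- 1) ^ (n - j) * (a k * of_nat j ^ k))
      = (\<lambda>k. a k * (fact n * of_nat (Stirling k n)))"
    by (auto simp: fact_Stirling_eq_sum sum_distrib_left mult_ac)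
  finally show "fact n * newton_coeff u n = (\<Sum>k. a k * (fact n * of_nat (Stirling k n)))"
    by (simp add: sums_iff newton_coeff_def)
qed

lemma newton_coeff_bound:
  assumes "u \<in> E1_space l"
  shows "fact n * norm (newton_coeff u n) \<le> E1_norm l u * (exp (exp 1 / 2 ^ l) - 1) ^ n"
proof -
  have "fact n * norm (newton_coeff u n) = norm (fact n * newton_coeff u n)" by (simp add: norm_mult)
  then show ?thesis
    using E1_taylor_Stirling(2,3)[OF assms refl, of n]
      summable_norm[OF E1_taylor_Stirling(1)[OF assms refl, of n]] by simp
qed

lemma exp_small:
  assumes "0 < c"
  obtains l where "exp (exp 1 / 2 ^ l) - 1 \<le> (c :: real)"
proof -
  have "(\<lambda>l. exp (exp 1 / 2 ^ l) - 1 :: real) \<longlonglongrightarrow> 0"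
    by real_asymp
  then have "eventually (\<lambda>l. exp (exp 1 / 2 ^ l) - 1 < c) sequentially"
    using assms by (rule order_tendstoD)
  then show ?thesis using that less_imp_le unfolding eventually_at_top_linorder by blast
qed

lemma newton_coeff_H1:
  obtains l where "\<And>u. u \<in> E1_space l \<Longrightarrow> newton_coeff u \<in> H1_space q \<and> H1_norm q (newton_coeff u) \<le> 2 * E1_norm l u"
proof -
  \<comment> \<open>The factor 1 / sqrt 2^q cancels the weight of the norm. The factor 1/2 leaves,
    after squaring, a geometric series with sum 4/3, whose square root is below 2.\<close>
  obtain l where l: "exp (exp 1 / 2 ^ l) - 1 \<le> 1 / (2 * sqrt 2 ^ q)"
    by (rule exp_small[of "1 / (2 * sqrt 2 ^ q)"]) auto
  show ?thesis
  proof (rule that[of l])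
    fix u assume u: "u \<in> E1_space l"
    let ?E = "E1_norm l u"
    let ?t = "\<lambda>n. (fact n)\<^sup>2 * 2 ^ (n * q) * (norm (newton_coeff u n))\<^sup>2"
    have le: "?t n \<le> ?E\<^sup>2 * (1 / 4) ^ n" for n
    proof -
      have "fact n * norm (newton_coeff u n) \<le> ?E * (1 / (2 * sqrt 2 ^ q)) ^ n"
        using newton_coeff_bound[OF u, of n] E1_norm_nonneg[OF u] power_mono[OF l, of n] 
        by (smt (verit, best) mult_left_mono exp_ge_add_one_self divide_nonneg_nonneg exp_ge_zero zero_le_power)
      then have "(fact n * norm (newton_coeff u n))\<^sup>2 \<le> (?E * (1 / (2 * sqrt 2 ^ q)) ^ n)\<^sup>2"
        by (intro power_mono) auto
      then have "2 ^ (n * q) * (fact n * norm (newton_coeff u n))\<^sup>2 \<le> 2 ^ (n * q) * (?E * (1 / (2 * sqrt 2 ^ q)) ^ n)\<^sup>2"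
        by (intro mult_left_mono) auto
      also have "(?E * (1 / (2 * sqrt 2 ^ q)) ^ n)\<^sup>2 = ?E\<^sup>2 * ((1 / (2 * sqrt 2 ^ q))\<^sup>2) ^ n"
        by (simp add: power_mult_distrib flip: power_mult) (simp add: mult.commute)
      also have "(1 / (2 * sqrt 2 ^ q))\<^sup>2 = 1 / (4 * 2 ^ q :: real)"
      proof -
        have "(sqrt 2 ^ q)\<^sup>2 = (2 :: real) ^ q"
          by (metis power_commutes power_mult real_sqrt_pow2 zero_le_numeral mult.commute)
        then show ?thesis by (simp add: power_divide power_mult_distrib)
      qed
      also have "2 ^ (n * q) * (?E\<^sup>2 * (1 / (4 * 2 ^ q)) ^ n) = ?E\<^sup>2 * (1 / 4) ^ n"
        by (simp add: power_divide power_mult_distrib power_mult[symmetric] mult.commute)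
      finally show ?thesis by (simp add: power_mult_distrib mult_ac)
    qed
    have g: "(\<lambda>n. ?E\<^sup>2 * (1 / 4) ^ n) sums (?E\<^sup>2 * (1 / (1 - 1 / 4)))"
      by (intro sums_mult geometric_sums) auto
    have s: "summable ?t"
      using sums_summable[OF g] by (rule summable_comparison_test') (use le in auto)
    have "suminf ?t \<le> ?E\<^sup>2 * (1 / (1 - 1 / 4))"
      unfolding sums_unique[OF g] by (intro suminf_le le s sums_summable[OF g])
    also have "\<dots> \<le> (2 * ?E)\<^sup>2" by (simp add: power_mult_distrib)
    finally have "H1_norm q (newton_coeff u) \<le> sqrt ((2 * ?E)\<^sup>2)"
      unfolding H1_norm_def by (rule real_sqrt_le_mono)
    also have "\<dots> = \<bar>2 * ?E\<bar>" by (rule real_sqrt_abs)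
    finally have "H1_norm q (newton_coeff u) \<le> \<bar>2 * ?E\<bar>" .
    then show "newton_coeff u \<in> H1_space q \<and> H1_norm q (newton_coeff u) \<le> 2 * ?E"
      using s E1_norm_nonneg[OF u] by (simp add: H1_space_def)
  qed
qed

text \<open>Each power in the Taylor series of \<open>u\<close> is expanded in falling factorials;
  interchanging the sums gives the Newton series with the coefficients of
  \<open>E1_taylor_Stirling\<close>.\<close>

lemma newton_series_newton_coeff:
  assumes "u \<in> E1_min"
  shows "newton_series (newton_coeff u) = u"
proof
  fix z
  \<comment> \<open>The ratio 1/4 outweighs the factor \<open>2 ^ n\<close> from
    \<open>norm_gbinomial_le_powr\<close>, leaving (1/2)^n for absolute convergence.\<close>
  obtain l where l: "exp (exp 1 / 2 ^ l) - 1 \<le> (1 / 4 :: real)"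
    by (rule exp_small[of "1 / 4"]) auto
  have u: "u \<in> E1_space l" using assms by (auto simp: E1_min_def)
  define a where "a = (\<lambda>k. (deriv ^^ k) u 0 / fact k)"
  note T = E1_taylor_Stirling[OF u a_def]
  define f where "f = (\<lambda>n k. a k * (fact n * of_nat (Stirling k n)) * (z gchoose n))"
  have f1: "summable (\<lambda>k. norm (f n k))" for n
    unfolding f_def norm_mult[of _ "z gchoose n"] by (intro summable_mult2 T)
  have fb: "(\<Sum>k. norm (f n k)) \<le> E1_norm l u * 2 powr norm z * (1 / 2) ^ n" for n
  proof -
    have "(\<Sum>k. norm (f n k)) = (\<Sum>k. norm (a k * (fact n * of_nat (Stirling k n)))) * norm (z gchoose n)"
      unfolding f_def norm_mult[of _ "z gchoose n"] by (intro suminf_mult2[symmetric] T)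
    also have "\<dots> \<le> (E1_norm l u * (exp (exp 1 / 2 ^ l) - 1) ^ n) * (2 ^ n * 2 powr norm z)"
      by (intro mult_mono T norm_gbinomial_le_powr) (auto simp: E1_norm_nonneg[OF u])
    also have "\<dots> \<le> (E1_norm l u * (1 / 4) ^ n) * (2 ^ n * 2 powr norm z)"
      using l by (intro mult_right_mono mult_left_mono power_mono) (auto simp: E1_norm_nonneg[OF u])
    also have "\<dots> = E1_norm l u * 2 powr norm z * ((1 / 4) ^ n * 2 ^ n)" by (simp add: mult_ac)
    also have "(1 / 4) ^ n * 2 ^ n = (1 / 2 :: real) ^ n" by (simp flip: power_mult_distrib)
    finally show ?thesis .
  qed
  have f2: "summable (\<lambda>n. \<Sum>k. norm (f n k))"
  proof (rule summable_comparison_test')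
    show "summable (\<lambda>n. E1_norm l u * 2 powr norm z * (1 / 2) ^ n)"
      by (intro summable_mult summable_geometric) auto
    show "norm (\<Sum>k. norm (f n k)) \<le> E1_norm l u * 2 powr norm z * (1 / 2) ^ n" for n
      using fb[of n] suminf_nonneg[OF f1[of n]] by simp
  qed
  have "newton_series (newton_coeff u) z = (\<Sum>n. (fact n * newton_coeff u n) * (z gchoose n))"
    by (simp add: newton_series_def mult_ac)
  also have "\<dots> = (\<Sum>n. \<Sum>k. f n k)"
    unfolding T(3) f_def by (intro suminf_cong suminf_mult2 summable_norm_cancel[OF T(1)])
  also have "\<dots> = (\<Sum>k. \<Sum>n. f n k)" by (rule double_series_swap(3)[OF f1 f2])
  also have "\<dots> = (\<Sum>k. a k * z ^ k)"
  proof (intro suminf_cong)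
    fix k
    have "(\<Sum>n. f n k) = (\<Sum>n\<le>k. f n k)"
      by (rule suminf_finite) (auto simp: f_def)
    also have "\<dots> = a k * z ^ k"
      unfolding power_eq_sum_Stirling[of z k] by (simp add: f_def sum_distrib_left mult_ac)
    finally show "(\<Sum>n. f n k) = a k * z ^ k" .
  qed
  also have "\<dots> = u z"
  proof -
    have "u holomorphic_on ball 0 (norm z + 1)"
      using u by (auto simp: E1_space_def intro: holomorphic_on_subset)
    then show ?thesis
      using holomorphic_power_series[of u 0 "norm z + 1" z] by (simp add: a_def sums_iff)
  qed
  finally show "newton_series (newton_coeff u) z = u z" .
qed

subsection \<open>Continuity for topologies given by norms\<close>

lemma topspace_norms_topology:
  assumes "\<And>q. p q (\<lambda>a. 0) = 0"
  shows "topspace (norms_topology V p) = (V :: ('a \<Rightarrow> 'b :: ab_group_add) set)"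
proof -
  \<comment> \<open>Each point lies in its own unit ball; \<open>undefined\<close> stands for an
    arbitrary index of the norms.\<close>
  have "x \<in> \<Union> {{y \<in> V. p q (\<lambda>a. y a - x a) < e} | x q e. x \<in> V \<and> 0 < e}" if "x \<in> V" for x
    using that assms[of undefined]
    by (intro UnionI[of "{y \<in> V. p undefined (\<lambda>a. y a - x a) < 1}"] CollectI exI[of _ x] exI[of _ undefined] exI[of _ 1]) auto
  then show ?thesis
    unfolding norms_topology_def topology_generated_by_topspace by blast
qed

text \<open>The usual criterion for linear maps: every target norm is bounded by a multiple of one
  source norm. All hypotheses are phrased through differences, the only operation occurring in
  \<open>norms_topology\<close>.\<close>

lemma continuous_map_norms_topology:
  fixes T :: "('a \<Rightarrow> 'b :: ab_group_add) \<Rightarrow> ('c \<Rightarrow> 'd :: ab_group_add)"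
  assumes T: "\<And>x. x \<in> V \<Longrightarrow> T x \<in> W"
    and diff: "\<And>x y. x \<in> V \<Longrightarrow> y \<in> V \<Longrightarrow> (\<lambda>a. x a - y a) \<in> V"
    and diffW: "\<And>x y. x \<in> W \<Longrightarrow> y \<in> W \<Longrightarrow> (\<lambda>a. x a - y a) \<in> W"
    and linear: "\<And>x y. x \<in> V \<Longrightarrow> y \<in> V \<Longrightarrow> T (\<lambda>a. x a - y a) = (\<lambda>a. T x a - T y a)"
    and zero: "\<And>q. p q (\<lambda>a. 0) = 0" "\<And>l. p' l (\<lambda>a. 0) = 0"
    and nonneg: "\<And>q x. x \<in> V \<Longrightarrow> 0 \<le> p q x"
    and tri: "\<And>l x y. x \<in> W \<Longrightarrow> y \<in> W \<Longrightarrow> p' l (\<lambda>a. x a - y a) \<le> p' l x + p' l y"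
    and bound: "\<And>l. \<exists>q C. \<forall>x\<in>V. p' l (T x) \<le> C * p q x"
  shows "continuous_map (norms_topology V p) (norms_topology W p') T"
proof -
  have tV: "topspace (norms_topology V p) = V" by (rule topspace_norms_topology) (rule zero)
  have tW: "topspace (norms_topology W p') = W" by (rule topspace_norms_topology) (rule zero)
  \<comment> \<open>Symmetry of the distance comes from \<open>tri\<close> applied to 0 and the
    difference.\<close>
  have neg: "p' l (\<lambda>a. y a - x a) \<le> p' l (\<lambda>a. x a - y a)" if "x \<in> W" "y \<in> W" for l x y
  proof -
    have d: "(\<lambda>a. x a - y a) \<in> W" by (rule diffW[OF that])
    have z: "(\<lambda>a. 0) \<in> W" using diffW[OF that(1) that(1)] by simp
    show ?thesis using tri[OF z d, of l] zero(2)[of l] by simp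
  qed
  show ?thesis
    unfolding norms_topology_def[of W]
  proof (rule continuous_on_generated_topo)
    show "T ` topspace (norms_topology V p) \<subseteq> \<Union> {{y \<in> W. p' q (\<lambda>a. y a - x a) < e} | x q e. x \<in> W \<and> 0 < e}"
      using T tV tW unfolding norms_topology_def[of W] topology_generated_by_topspace by auto
  next
    fix U assume "U \<in> {{y \<in> W. p' q (\<lambda>a. y a - x a) < e} | x q e. x \<in> W \<and> 0 < e}"
    then obtain w l e where w: "w \<in> W" and U: "U = {y \<in> W. p' l (\<lambda>a. y a - w a) < e}" by blast
    obtain q C where C: "\<And>x. x \<in> V \<Longrightarrow> p' l (T x) \<le> C * p q x" using bound[of l] by blast
    show "openin (norms_topology V p) (T -` U \<inter> topspace (norms_topology V p))"
    proof (subst openin_subopen, intro ballI)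
      fix x assume "x \<in> T -` U \<inter> topspace (norms_topology V p)"
      then have x: "x \<in> V" "p' l (\<lambda>a. T x a - w a) < e" by (auto simp: U tV)
      \<comment> \<open>The numerator is the room left between \<open>T x\<close> and the boundary
        of the ball around \<open>w\<close>; \<open>\<bar>C\<bar> + 1\<close> is positive and at
        least \<open>C\<close>.\<close>
      define r where "r = (e - p' l (\<lambda>a. T x a - w a)) / (\<bar>C\<bar> + 1)"
      have r: "r > 0" using x by (simp add: r_def)
      let ?B = "{y \<in> V. p q (\<lambda>a. y a - x a) < r}"
      have "openin (norms_topology V p) ?B"
        unfolding norms_topology_def using x r by (intro topology_generated_by_Basis) blast
      moreover have "x \<in> ?B" using x r zero by simp
      moreover have "?B \<subseteq> T -` U \<inter> topspace (norms_topology V p)"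
      proof
        fix y assume y: "y \<in> ?B"
        then have yV: "y \<in> V" by simp
        have d: "(\<lambda>a. y a - x a) \<in> V" using diff yV x by blast
        have "p' l (\<lambda>a. T y a - T x a) \<le> C * p q (\<lambda>a. y a - x a)"
          using C[OF d] linear[OF yV x(1)] by simp
        also have "\<dots> \<le> (\<bar>C\<bar> + 1) * p q (\<lambda>a. y a - x a)"
          using nonneg[OF d] by (intro mult_right_mono) auto
        also have "\<dots> < (\<bar>C\<bar> + 1) * r" using y by (intro mult_strict_left_mono) auto
        also have "\<dots> = e - p' l (\<lambda>a. T x a - w a)" by (simp add: r_def)
        finally have 1: "p' l (\<lambda>a. T y a - T x a) < e - p' l (\<lambda>a. T x a - w a)" .
        have m: "(\<lambda>a. T y a - T x a) \<in> W" "(\<lambda>a. w a - T x a) \<in> W"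
          using T yV x w by (auto intro!: diffW)
        have "p' l (\<lambda>a. T y a - w a) \<le> p' l (\<lambda>a. T y a - T x a) + p' l (\<lambda>a. w a - T x a)"
          using tri[OF m, of l] by simp
        also have "p' l (\<lambda>a. w a - T x a) \<le> p' l (\<lambda>a. T x a - w a)"
          by (rule neg) (use T x w in auto)
        finally have "p' l (\<lambda>a. T y a - w a) < e" using 1 by linarith
        then show "y \<in> T -` U \<inter> topspace (norms_topology V p)"
          using T yV by (simp add: U tV)
      qed
      ultimately show "\<exists>B. openin (norms_topology V p) B \<and> x \<in> B \<and> B \<subseteq> T -` U \<inter> topspace (norms_topology V p)"
        by blast
    qed
  qed
qed

section \<open>The Newton series as a homeomorphism, and the convolution\<close>

lemma homeomorphic_maps_newton_series:
  "homeomorphic_maps N1_topology E1_min_topology newton_series newton_coeff"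
proof -
  have H0: "H1_norm q (\<lambda>n. 0) = 0" for q by (simp add: H1_norm_def)
  have E0: "E1_norm l (\<lambda>z. 0) = 0" for l by (simp add: E1_norm_def)
  have N1: "\<phi> \<in> H1_space q" if "\<phi> \<in> N1_space" for \<phi> q using that by (auto simp: N1_space_def)
  have E1: "u \<in> E1_space l" if "u \<in> E1_min" for u l using that by (auto simp: E1_min_def)
  have N1d: "(\<lambda>n. \<phi> n - \<psi> n) \<in> N1_space" if "\<phi> \<in> N1_space" "\<psi> \<in> N1_space" for \<phi> \<psi>
    using H1_diff(1) that by (auto simp: N1_space_def)
  have E1d: "(\<lambda>z. u z - v z) \<in> E1_min" if "u \<in> E1_min" "v \<in> E1_min" for u v
    using E1_diff(1) that by (auto simp: E1_min_def)
  have into: "newton_series \<phi> \<in> E1_min" if "\<phi> \<in> N1_space" for \<phi>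
    unfolding E1_min_def
  proof
    fix l show "newton_series \<phi> \<in> E1_space l"
      by (rule newton_series_E1[of l]) (use N1[OF that] in auto)
  qed
  have into': "newton_coeff u \<in> N1_space" if "u \<in> E1_min" for u
    unfolding N1_space_def
  proof
    fix q show "newton_coeff u \<in> H1_space q"
      by (rule newton_coeff_H1[of q]) (use E1[OF that] in auto)
  qed
  have sN: "summable (\<lambda>n. \<phi> n * fact n * (z gchoose n))" if "\<phi> \<in> N1_space" for \<phi> z
    by (rule summable_norm_cancel, rule newton_series_bound(2)[OF N1[OF that, of 1]]) simp
  have "continuous_map N1_topology E1_min_topology newton_series"
    unfolding N1_topology_def E1_min_topology_def
  proof (rule continuous_map_norms_topology)
    fix \<phi> \<psi> assume "\<phi> \<in> N1_space" "\<psi> \<in> N1_space"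
    then have "summable (\<lambda>n. \<phi> n * fact n * (z gchoose n))" "summable (\<lambda>n. \<psi> n * fact n * (z gchoose n))" for z
      by (auto intro: sN)
    then show "newton_series (\<lambda>n. \<phi> n - \<psi> n) = (\<lambda>z. newton_series \<phi> z - newton_series \<psi> z)"
      unfolding newton_series_def by (auto simp: suminf_diff left_diff_distrib)
  next
    fix l
    obtain q where "\<And>\<phi>. \<phi> \<in> H1_space q \<Longrightarrow> E1_norm l (newton_series \<phi>) \<le> H1_norm q \<phi>"
      by (rule newton_series_E1[of l]) auto
    then show "\<exists>q C. \<forall>\<phi>\<in>N1_space. E1_norm l (newton_series \<phi>) \<le> C * H1_norm q \<phi>"
      using N1 by (intro exI[of _ q] exI[of _ 1]) auto
  qed (use N1 E1 into N1d E1d H0 E0 H1_norm_nonneg E1_diff in auto)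
  moreover have "continuous_map E1_min_topology N1_topology newton_coeff"
    unfolding N1_topology_def E1_min_topology_def
  proof (rule continuous_map_norms_topology)
    fix u v :: "complex \<Rightarrow> complex"
    show "newton_coeff (\<lambda>z. u z - v z) = (\<lambda>n. newton_coeff u n - newton_coeff v n)"
      by (auto simp: newton_coeff_def sum_subtractf right_diff_distrib diff_divide_distrib)
  next
    fix q
    obtain l where "\<And>u. u \<in> E1_space l \<Longrightarrow> H1_norm q (newton_coeff u) \<le> 2 * E1_norm l u"
      by (rule newton_coeff_H1[of q]) auto
    then show "\<exists>l C. \<forall>u\<in>E1_min. H1_norm q (newton_coeff u) \<le> C * E1_norm l u"
      using E1 by (intro exI[of _ l] exI[of _ 2]) auto
  qed (use N1 E1 into' N1d E1d H0 E0 E1_norm_nonneg H1_diff in auto)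
  moreover have "topspace N1_topology = N1_space" "topspace E1_min_topology = E1_min"
    unfolding N1_topology_def E1_min_topology_def
    by (rule topspace_norms_topology, rule H0, rule topspace_norms_topology, rule E0)
  ultimately show ?thesis
    unfolding homeomorphic_maps_def
    by (simp add: newton_coeff_newton_series newton_series_newton_coeff)
qed

text \<open>Integrability is asserted separately because the Bochner integral of a function that is
  not integrable is 0 by convention.\<close>

theorem theorem6p1:
  fixes lam \<beta> :: real
  assumes "0 < lam" and "0 < \<beta>" and "\<beta> \<le> 1"
  shows "(\<forall>\<phi>\<in>N1_space. \<forall>z. integrable (frac_poisson lam \<beta>)
            (\<lambda>x. series_eval lam \<beta> \<phi> (of_real x + z))) \<and>
         homeomorphic_map N1_topology E1_min_topology (convolution lam \<beta>)"
proof
  show "\<forall>\<phi>\<in>N1_space. \<forall>z. integrable (frac_poisson lam \<beta>)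
            (\<lambda>x. series_eval lam \<beta> \<phi> (of_real x + z))"
    using convolution_eq_newton_series(1)[OF assms] by blast
  have "topspace N1_topology = N1_space"
    unfolding N1_topology_def by (rule topspace_norms_topology) (simp add: H1_norm_def)
  \<comment> \<open>Being a homeomorphism depends only on the values on the underlying space, and
    there the two maps agree.\<close>
  then have "newton_series \<phi> = convolution lam \<beta> \<phi>" if "\<phi> \<in> topspace N1_topology" for \<phi>
    using convolution_eq_newton_series(2)[OF assms] that by auto
  moreover have "homeomorphic_map N1_topology E1_min_topology newton_series"
    using homeomorphic_maps_newton_series homeomorphic_map_maps by blast
  ultimately show "homeomorphic_map N1_topology E1_min_topology (convolution lam \<beta>)"
    by (rule homeomorphic_map_eq[rotated])
qed

end
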